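(* Let $H$ be a real Hilbert space, let $m\ge1$, let $\mathcal{A}_i:H\to2^H$ ($i=1,\dots,m$) be maximally monotone, let $\mathcal{B}:H\to H$ be monotone and $L$-Lipschitz ($L>0$), let $\mathcal{C}:H\to H$ be $\beta$-cocoercive ($\beta>0$), and assume that the set of $\mathbf{x}\in H$ with $0\in\sum_{i=1}^m\mathcal{A}_i\mathbf{x}+\mathcal{B}\mathbf{x}+\mathcal{C}\mathbf{x}$ is nonempty. Let $\omega_1,\dots,\omega_m\in(0,1]$ with $\sum_i\omega_i=1$. Let $$a=\frac{17\beta L+10+\sqrt{(17\beta L+10)^2+144\beta^2L^2}}{6\beta L},\qquad\gamma\in\left(0,\frac{\beta}{5+(10+\frac6a)\beta L}\right).$$ Let $(\mathbf{z}_{i,0})_{i},(\mathbf{y}_{i,0})_i,(\mathbf{y}_{i,-1})_i\in H^m$ and iterate, for $n\ge0$, $$\mathbf{x}_{n+1}=\sum_{j=1}^m\omega_j\mathbf{z}_{j,n},$$ and for $i=1,\dots,m$: $$\mathbf{y}_{i,n+1}=J_{\frac{\gamma}{\omega_i}\mathcal{A}_i}\big(2\mathbf{x}_{n+1}-\mathbf{z}_{i,n}-\gamma\mathcal{B}(2\mathbf{y}_{i,n}-\mathbf{y}_{i,n-1})-\gamma\mathcal{C}\mathbf{y}_{i,n}\big),\qquad \mathbf{z}_{i,n+1}=\mathbf{z}_{i,n}+\mathbf{y}_{i,n+1}-\mathbf{x}_{n+1}.$$ Then $\{\mathbf{x}_n\}$ converges weakly to a point $\mathbf{x}$ satisfying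 $0\in\sum_{i=1}^m\mathcal{A}_i\mathbf{x}+\mathcal{B}\mathbf{x}+\mathcal{C}\mathbf{x}$.
   Context: $J_{T}=(\mathrm{Id}+T)^{-1}$ is the resolvent of a maximally monotone operator $T$. $\beta$-cocoercive means $\langle x-y,\mathcal{C}x-\mathcal{C}y\rangle\ge\beta\|\mathcal{C}x-\mathcal{C}y\|^2$ for all $x,y$. *)

theory Defs
  imports "HOL-Analysis.Analysis"
begin

definition monotone_op :: "('a::real_inner \<Rightarrow> 'a set) \<Rightarrow> bool" where
  "monotone_op A \<longleftrightarrow> (\<forall>x y u v. u \<in> A x \<longrightarrow> v \<in> A y \<longrightarrow> 0 \<le> (x - y) \<bullet> (u - v))"

definition maximally_monotone :: "('a::real_inner \<Rightarrow> 'a set) \<Rightarrow> bool" where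
  "maximally_monotone A \<longleftrightarrow> monotone_op A \<and>
     (\<forall>x u. (\<forall>y v. v \<in> A y \<longrightarrow> 0 \<le> (x - y) \<bullet> (u - v)) \<longrightarrow> u \<in> A x)"

definition monotone_fun :: "('a::real_inner \<Rightarrow> 'a) \<Rightarrow> bool" where
  "monotone_fun B \<longleftrightarrow> (\<forall>x y. 0 \<le> (x - y) \<bullet> (B x - B y))"

definition cocoercive :: "real \<Rightarrow> ('a::real_inner \<Rightarrow> 'a) \<Rightarrow> bool" where
  "cocoercive \<beta> C \<longleftrightarrow> (\<forall>x y. \<beta> * (norm (C x - C y))\<^sup>2 \<le> (x - y) \<bullet> (C x - C y))"

definition scale_op :: "real \<Rightarrow> ('a::real_vector \<Rightarrow> 'a set) \<Rightarrow> 'a \<Rightarrow> 'a set" where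
  "scale_op c A x = (\<lambda>u. c *\<^sub>R u) ` A x"

text \<open>Resolvent J_A = (Id + A)^{-1}: J_A w is the (unique, for A maximally monotone) y with w in y + A y.\<close>
definition resolvent :: "('a::real_vector \<Rightarrow> 'a set) \<Rightarrow> 'a \<Rightarrow> 'a" where
  "resolvent A w = (THE y. w - y \<in> A y)"

definition zer_sum :: "nat \<Rightarrow> (nat \<Rightarrow> 'a::real_vector \<Rightarrow> 'a set) \<Rightarrow> ('a \<Rightarrow> 'a) \<Rightarrow> ('a \<Rightarrow> 'a) \<Rightarrow> 'a set" where
  "zer_sum m A B C = {x. \<exists>u. (\<forall>i\<in>{1..m}. u i \<in> A i x) \<and> (\<Sum>i=1..m. u i) + B x + C x = 0}"

definition weakly_converges :: "(nat \<Rightarrow> 'a::real_inner) \<Rightarrow> 'a \<Rightarrow> bool" where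
  "weakly_converges x p \<longleftrightarrow> (\<forall>v. (\<lambda>n. x n \<bullet> v) \<longlonglongrightarrow> p \<bullet> v)"

end

theory Submission
  imports Defs
begin

text \<open>
  In the product space with weights \<open>\<omega>\<close>, write \<open>P\<close> for the projection onto the diagonal, so that
  \<open>x\<^sub>n\<^sub>+\<^sub>1 = P z\<^sub>n\<close>.  Monotonicity of the \<open>A\<^sub>i\<close> between an iterate and a solution bounds the
  change of the squared distance of \<open>z\<^sub>n\<close> to a fixed point; the reflected argument
  \<open>2 y\<^sub>n - y\<^sub>n\<^sub>-\<^sub>1\<close> makes the contribution of \<open>B\<close> telescope up to products of increments of \<open>y\<close>.
  Monotonicity between consecutive iterates bounds the growth of the increments of \<open>z\<close>.
  The first estimate plus \<open>3/4\<close> times the second gives a Lyapunov function as soon as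
  \<open>2 \<gamma> / \<beta> + 21/2 \<gamma> L < 1\<close>, and the bound on \<open>\<gamma>\<close> implies this.  Hence all increments
  vanish and the distance to every fixed point converges.

  Points common to all half-spaces that eventually contain \<open>z\<^sub>n\<close> take the role of weak cluster
  points.  They are fixed points, because the monotonicity inequality of the iterates is
  asymptotically affine in \<open>z\<^sub>n\<close>, and Opial's argument shows that there is only one.  That the
  resolvents are defined everywhere is Minty's theorem, proved by minimising the Fitzpatrick
  function plus half the squared norm.
\<close>

subsection \<open>Minty's theorem and resolvents\<close>

text \<open>The parallelogram law, solved for the distance: two nearly norm-minimal elements of a
  convex set must be close, since their midpoint cannot do better than the infimum.\<close>

lemma midpoint_sq:
  fixes u v :: "'a::real_inner"
  shows "(norm (u - v))\<^sup>2 = 2 * (norm u)\<^sup>2 + 2 * (norm v)\<^sup>2 - 4 * (norm ((1/2) *\<^sub>R (u + v)))\<^sup>2"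
  by (simp add: power2_norm_eq_inner inner_simps inner_commute algebra_simps)

text \<open>\<open>K\<close> plays the role of the epigraph of a closed convex function that may
  take the value infinity. Half the squared norm makes the objective strongly convex, so a
  minimising sequence is Cauchy in its first component; convergence of the objective values then
  gives convergence of the second.\<close>

lemma strongly_convex_attains_inf:
  fixes K :: "('b::{real_inner,complete_space} \<times> real) set"
  assumes cl: "closed K" and cv: "convex K" and ne: "K \<noteq> {}"
    and lb: "\<And>w t. (w, t) \<in> K \<Longrightarrow> 0 \<le> t + (norm w)\<^sup>2 / 2"
  obtains w t where "(w, t) \<in> K"
    "\<And>w' t'. (w', t') \<in> K \<Longrightarrow> t + (norm w)\<^sup>2 / 2 \<le> t' + (norm w')\<^sup>2 / 2"
proof -
  define \<delta> where "\<delta> n = inverse (real (Suc n))" for n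
  have \<delta>_pos: "0 < \<delta> n" for n by (simp add: \<delta>_def)
  have \<delta>_mono: "\<delta> l \<le> \<delta> n" if "n \<le> l" for n l using that by (simp add: \<delta>_def)
  have \<delta>_small: "\<exists>n. \<delta> n < e" if "0 < e" for e
    using reals_Archimedean[OF that] by (simp add: \<delta>_def)
  define f :: "'b \<times> real \<Rightarrow> real" where "f k = snd k + (norm (fst k))\<^sup>2 / 2" for k
  define \<mu> where "\<mu> = Inf (f ` K)"
  have bdd: "bdd_below (f ` K)"
    using lb by (auto simp: f_def intro!: bdd_belowI[where m=0])
  have \<mu>_le: "\<mu> \<le> f k" if "k \<in> K" for k
    unfolding \<mu>_def using bdd that by (simp add: cINF_lower)
  have "\<exists>k\<in>K. f k < \<mu> + \<delta> n" for n
    using cInf_lessD[of "f ` K" "\<mu> + \<delta> n"] ne \<delta>_pos by (auto simp: \<mu>_def)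
  then obtain k where kK: "\<And>n. k n \<in> K" and kf: "\<And>n. f (k n) < \<mu> + \<delta> n"
    by metis
  \<comment> \<open>At the midpoint the objective is an eighth of the squared distance below the
    average of its values at \<open>k i\<close> and \<open>k j\<close>, yet it stays above the
    infimum.\<close>
  have mid: "(norm (fst (k i) - fst (k j)))\<^sup>2 \<le> 4 * (\<delta> i + \<delta> j)" for i j
  proof -
    have "(1/2) *\<^sub>R (k i + k j) \<in> K"
      using convexD[OF cv kK[of i] kK[of j], of "1/2" "1/2"] by (simp add: scaleR_add_right)
    then have "\<mu> \<le> f ((1/2) *\<^sub>R (k i + k j))" by (rule \<mu>_le)
    also have "\<dots> = f (k i) / 2 + f (k j) / 2 - (norm (fst (k i) - fst (k j)))\<^sup>2 / 8"
      unfolding f_def midpoint_sq[of "fst (k i)" "fst (k j)"]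
      by (simp add: field_simps)
    finally show ?thesis using kf[of i] kf[of j] by simp
  qed
  have "Cauchy (\<lambda>n. fst (k n))"
  proof (rule metric_CauchyI)
    fix e :: real assume e: "0 < e"
    then obtain M where M: "\<delta> M < e\<^sup>2 / 8"
      using \<delta>_small[of "e\<^sup>2 / 8"] by auto
    have "dist (fst (k i)) (fst (k j)) < e" if "i \<ge> M" "j \<ge> M" for i j
    proof -
      have "\<delta> i \<le> \<delta> M" "\<delta> j \<le> \<delta> M"
        using that \<delta>_mono by auto
      then have "(norm (fst (k i) - fst (k j)))\<^sup>2 < e\<^sup>2"
        using mid[of i j] M by argo
      then show ?thesis using e by (simp add: dist_norm power2_less_imp_less)
    qed
    then show "\<exists>M. \<forall>m\<ge>M. \<forall>n\<ge>M. dist (fst (k m)) (fst (k n)) < e" by blast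
  qed
  then obtain w where w: "(\<lambda>n. fst (k n)) \<longlonglongrightarrow> w" by (auto simp: Cauchy_convergent_iff convergent_def)
  have "(\<lambda>n. \<mu> + \<delta> n) \<longlonglongrightarrow> \<mu> + 0" unfolding \<delta>_def
    by (intro tendsto_add tendsto_const) (rule LIMSEQ_inverse_real_of_nat)
  then have "(\<lambda>n. f (k n)) \<longlonglongrightarrow> \<mu>"
    by (intro tendsto_sandwich[of "\<lambda>_. \<mu>" "\<lambda>n. f (k n)" sequentially "\<lambda>n. \<mu> + \<delta> n"]
        always_eventually allI \<mu>_le[OF kK] less_imp_le[OF kf] tendsto_const) simp
  then have "(\<lambda>n. f (k n) - (norm (fst (k n)))\<^sup>2 / 2) \<longlonglongrightarrow> \<mu> - (norm w)\<^sup>2 / 2"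
    by (intro tendsto_intros w) auto
  then have "(\<lambda>n. snd (k n)) \<longlonglongrightarrow> \<mu> - (norm w)\<^sup>2 / 2"
    by (simp add: f_def)
  with w have "(\<lambda>n. (fst (k n), snd (k n))) \<longlonglongrightarrow> (w, \<mu> - (norm w)\<^sup>2 / 2)"
    by (rule tendsto_Pair)
  then have "(w, \<mu> - (norm w)\<^sup>2 / 2) \<in> K"
    using closed_sequentially[OF cl, of k] kK by simp
  then show thesis
  proof (rule that)
    fix w' t' assume "(w', t') \<in> K"
    from \<mu>_le[OF this] show "\<mu> - (norm w)\<^sup>2 / 2 + (norm w)\<^sup>2 / 2 \<le> t' + (norm w')\<^sup>2 / 2"
      by (simp add: f_def)
  qed
qed

section \<open>Minty's theorem by way of the Fitzpatrick function\<close>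

lemma maximally_monotone_monotone:
  assumes "maximally_monotone A" "u \<in> A x" "v \<in> A y"
  shows "0 \<le> (x - y) \<bullet> (u - v)"
  using assms unfolding maximally_monotone_def monotone_op_def by blast

lemma maximally_monotoneD:
  assumes "maximally_monotone A" "\<And>y v. v \<in> A y \<Longrightarrow> 0 \<le> (x - y) \<bullet> (u - v)"
  shows "u \<in> A x"
  using assms unfolding maximally_monotone_def by blast

text \<open>At the minimiser \<open>(y, v)\<close> of the Fitzpatrick function plus half the squared
  norm, first-order optimality tested on the graph of \<open>A\<close> gives \<open>key\<close>. By
  maximality this puts \<open>(- v, - y)\<close> into the graph, and \<open>key\<close> at this very
  point forces \<open>v = - y\<close>.\<close>

lemma Minty_zero:
  fixes A :: "'a::{real_inner,complete_space} \<Rightarrow> 'a set"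
  assumes A: "maximally_monotone A"
  shows "\<exists>y. - y \<in> A y"
proof -
  \<comment> \<open>the epigraph of the Fitzpatrick function of \<open>A\<close>, which majorises the duality pairing
    and agrees with it on the graph of \<open>A\<close>\<close>
  define K :: "(('a \<times> 'a) \<times> real) set" where
    "K = (\<Inter>x. \<Inter>u\<in>A x. {k. fst (fst k) \<bullet> u + x \<bullet> snd (fst k) - x \<bullet> u \<le> snd k})"
  have K_iff: "((y, v), t) \<in> K \<longleftrightarrow> (\<forall>x. \<forall>u\<in>A x. y \<bullet> u + x \<bullet> v - x \<bullet> u \<le> t)" for y v t
    by (simp add: K_def)
  have cl: "closed K"
    unfolding K_def by (intro closed_INT ballI closed_Collect_le continuous_intros)
  have cv: "convex K"
    unfolding K_def
  proof (intro convex_INT ballI)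
    fix x u
    show "convex {k :: ('a \<times> 'a) \<times> real. fst (fst k) \<bullet> u + x \<bullet> snd (fst k) - x \<bullet> u \<le> snd k}"
    proof (rule convexI, unfold mem_Collect_eq)
      fix k k' :: "('a \<times> 'a) \<times> real" and a b :: real
      assume k: "fst (fst k) \<bullet> u + x \<bullet> snd (fst k) - x \<bullet> u \<le> snd k"
        and k': "fst (fst k') \<bullet> u + x \<bullet> snd (fst k') - x \<bullet> u \<le> snd k'"
        and ab: "0 \<le> a" "0 \<le> b" "a + b = 1"
      have "a * (fst (fst k) \<bullet> u + x \<bullet> snd (fst k)) + b * (fst (fst k') \<bullet> u + x \<bullet> snd (fst k')) - (a + b) * (x \<bullet> u)
          \<le> a * snd k + b * snd k'"
        using add_mono[OF mult_left_mono[OF k ab(1)] mult_left_mono[OF k' ab(2)]]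
        by (simp add: algebra_simps)
      then show "fst (fst (a *\<^sub>R k + b *\<^sub>R k')) \<bullet> u + x \<bullet> snd (fst (a *\<^sub>R k + b *\<^sub>R k')) - x \<bullet> u
          \<le> snd (a *\<^sub>R k + b *\<^sub>R k')"
        unfolding ab(3) by (simp add: inner_add_left inner_add_right algebra_simps)
    qed
  qed
  have graph: "((x, u), x \<bullet> u) \<in> K" if "u \<in> A x" for x u
    unfolding K_iff
  proof (intro allI ballI)
    fix x' u' assume "u' \<in> A x'"
    from maximally_monotone_monotone[OF A that this]
    show "x \<bullet> u' + x' \<bullet> u - x' \<bullet> u' \<le> x \<bullet> u" by (simp add: inner_simps)
  qed
  \<comment> \<open>If the graph were empty, \<open>(0, 0)\<close> would vacuously be monotonically
    related to all of it and hence belong to it.\<close>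
  have "\<exists>x u. u \<in> A x"
    using maximally_monotoneD[OF A, of 0 0] by blast
  with graph have ne: "K \<noteq> {}" by blast
  \<comment> \<open>A pair outside the graph violates monotonicity against some graph point, and the
    affine function belonging to that point exceeds \<open>y \<bullet> v\<close> at
    \<open>(y, v)\<close>.\<close>
  have above: "y \<bullet> v \<le> t" if k: "((y, v), t) \<in> K" for y v t
  proof (cases "v \<in> A y")
    case True
    with k show ?thesis unfolding K_iff by force
  next
    case False
    then obtain x u where u: "u \<in> A x" "(y - x) \<bullet> (v - u) < 0"
      using maximally_monotoneD[OF A, of y v] by (meson not_le)
    with k have "y \<bullet> u + x \<bullet> v - x \<bullet> u \<le> t" unfolding K_iff by blast
    with u(2) show ?thesis by (simp add: inner_simps)
  qed
  have sq: "(norm (y, v))\<^sup>2 = (norm y)\<^sup>2 + (norm v)\<^sup>2" for y v :: 'a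
    by (simp add: norm_Pair)
  have lb: "0 \<le> t + (norm w)\<^sup>2 / 2" if k: "(w, t) \<in> K" for w t
  proof -
    obtain y v where w: "w = (y, v)" by fastforce
    have "0 \<le> (norm (y + v))\<^sup>2 / 2" by simp
    also have "\<dots> = y \<bullet> v + ((norm y)\<^sup>2 + (norm v)\<^sup>2) / 2"
      by (simp add: power2_norm_eq_inner inner_simps inner_commute field_simps)
    also have "\<dots> \<le> t + (norm w)\<^sup>2 / 2" using above k unfolding w sq by simp
    finally show ?thesis .
  qed
  obtain w t where wK: "(w, t) \<in> K"
    and min: "\<And>w' t'. (w', t') \<in> K \<Longrightarrow> t + (norm w)\<^sup>2 / 2 \<le> t' + (norm w')\<^sup>2 / 2"
    using strongly_convex_attains_inf[OF cl cv ne lb] by blast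
  obtain y v where w: "w = (y, v)" by fastforce
  \<comment> \<open>First-order optimality over the epigraph, from a short step of relative length
    \<open>s\<close> towards \<open>(w', t')\<close>; after division by \<open>s\<close> the
    quadratic error is at most \<open>e\<close>.\<close>
  have opt: "t - w \<bullet> (w' - w) \<le> t'" if k: "(w', t') \<in> K" for w' t'
  proof (rule field_le_epsilon)
    fix e :: real assume e: "0 < e"
    \<comment> \<open>The added 1 keeps the quotient positive when \<open>w' = w\<close>; the
      minimum keeps the step inside the segment.\<close>
    define s where "s = min 1 (2 * e / ((norm (w' - w))\<^sup>2 + 1))"
    have den: "0 < (norm (w' - w))\<^sup>2 + 1"
      by (meson add_nonneg_pos zero_le_power2 zero_less_one)
    have s: "0 < s" "s \<le> 1" using e den by (auto simp: s_def)
    have "s * (norm (w' - w))\<^sup>2 \<le> (2 * e / ((norm (w' - w))\<^sup>2 + 1)) * ((norm (w' - w))\<^sup>2 + 1)"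
      using s den e by (intro mult_mono) (auto simp: s_def)
    also have "\<dots> = 2 * e" using den by simp
    finally have se: "s * (norm (w' - w))\<^sup>2 \<le> 2 * e" .
    have "(1 - s) *\<^sub>R (w, t) + s *\<^sub>R (w', t') \<in> K"
      using convexD[OF cv wK k, of "1 - s" s] s by simp
    then have "(w + s *\<^sub>R (w' - w), t + s * (t' - t)) \<in> K"
      by (simp add: algebra_simps)
    note min[OF this]
    also have "(norm (w + s *\<^sub>R (w' - w)))\<^sup>2 =
        (norm w)\<^sup>2 + 2 * (s * (w \<bullet> (w' - w))) + s\<^sup>2 * (norm (w' - w))\<^sup>2"
      unfolding power2_norm_eq_inner inner_add_left inner_add_right inner_scaleR_left inner_scaleR_right
      by (simp only: inner_commute[of "w' - w" w] power2_eq_square) algebra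
    finally have "0 \<le> s * (t' - t) + s * (w \<bullet> (w' - w)) + s\<^sup>2 * (norm (w' - w))\<^sup>2 / 2"
      by argo
    also have "\<dots> = s * (t' - t + w \<bullet> (w' - w) + s * (norm (w' - w))\<^sup>2 / 2)"
      by (simp add: power2_eq_square algebra_simps)
    finally have "0 \<le> t' - t + w \<bullet> (w' - w) + s * (norm (w' - w))\<^sup>2 / 2"
      using s by (simp add: zero_le_mult_iff)
    with se show "t - w \<bullet> (w' - w) \<le> t' + e" by simp
  qed
  have key: "(norm (y + v))\<^sup>2 \<le> (x + v) \<bullet> (u + y)" if "u \<in> A x" for x u
  proof -
    have "t - y \<bullet> x - v \<bullet> u + (norm y)\<^sup>2 + (norm v)\<^sup>2 \<le> x \<bullet> u"
      using opt[OF graph[OF that]] unfolding w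
      by (simp add: power2_norm_eq_inner inner_simps inner_commute)
    moreover have "y \<bullet> v \<le> t" using above wK w by simp
    ultimately show ?thesis
      by (simp add: power2_norm_eq_inner inner_simps inner_commute)
  qed
  have "- y \<in> A (- v)"
  proof (rule maximally_monotoneD[OF A])
    fix x u assume "u \<in> A x"
    from key[OF this] have "0 \<le> (x + v) \<bullet> (u + y)" by (smt (verit) zero_le_power2)
    then show "0 \<le> (- v - x) \<bullet> (- y - u)"
      by (simp add: inner_simps algebra_simps)
  qed
  moreover from key[OF this] have "v = - y"
    by (simp add: eq_neg_iff_add_eq_0 add.commute)
  ultimately show ?thesis by auto
qed

text \<open>The operator is \<open>c A x - w\<close>, written as a preimage. Applying
  \<open>Minty_zero\<close> to it solves the resolvent equation for arbitrary \<open>c\<close> and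
  \<open>w\<close>.\<close>

lemma maximally_monotone_scale_translate:
  assumes A: "maximally_monotone A" and c: "0 < c"
  shows "maximally_monotone (\<lambda>x. {u. (1 / c) *\<^sub>R (u + w) \<in> A x})"
  unfolding maximally_monotone_def monotone_op_def mem_Collect_eq
proof (intro conjI allI impI)
  fix x y u v assume "(1 / c) *\<^sub>R (u + w) \<in> A x" "(1 / c) *\<^sub>R (v + w) \<in> A y"
  from maximally_monotone_monotone[OF A this]
  have "0 \<le> (1 / c) * ((x - y) \<bullet> (u - v))" by (simp add: inner_simps algebra_simps)
  then show "0 \<le> (x - y) \<bullet> (u - v)" using c by (simp add: zero_le_divide_iff)
next
  fix x u assume *: "\<forall>y v. (1 / c) *\<^sub>R (v + w) \<in> A y \<longrightarrow> 0 \<le> (x - y) \<bullet> (u - v)"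
  show "(1 / c) *\<^sub>R (u + w) \<in> A x"
  proof (rule maximally_monotoneD[OF A])
    fix y v assume "v \<in> A y"
    with c have "0 \<le> (x - y) \<bullet> (u - (c *\<^sub>R v - w))" using * by simp
    then have "0 \<le> (1 / c) * ((x - y) \<bullet> (u - (c *\<^sub>R v - w)))" using c by simp
    also have "\<dots> = (x - y) \<bullet> ((1 / c) *\<^sub>R (u + w) - v)" using c
      by (simp add: inner_simps field_simps)
    finally show "0 \<le> (x - y) \<bullet> ((1 / c) *\<^sub>R (u + w) - v)" .
  qed
qed

theorem Minty:
  fixes A :: "'a::{real_inner,complete_space} \<Rightarrow> 'a set"
  assumes "maximally_monotone A" "0 < c"
  shows "\<exists>y. (1 / c) *\<^sub>R (w - y) \<in> A y"
  using Minty_zero[OF maximally_monotone_scale_translate[OF assms, of w]] by simp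

text \<open>Existence by Minty and uniqueness by monotonicity make the definite description
  meaningful. In this form the resolvents enter the convergence proof.\<close>

lemma resolvent_inclusion:
  fixes A :: "'a::{real_inner,complete_space} \<Rightarrow> 'a set"
  assumes A: "maximally_monotone A" and c: "0 < c"
  shows "(1 / c) *\<^sub>R (w - resolvent (scale_op c A) w) \<in> A (resolvent (scale_op c A) w)"
proof -
  have eq: "w - y \<in> scale_op c A y \<longleftrightarrow> (1 / c) *\<^sub>R (w - y) \<in> A y" for y
    using c by (force simp: scale_op_def image_iff)
  have "\<exists>!y. w - y \<in> scale_op c A y"
    unfolding eq
  proof (rule ex_ex1I[OF Minty[OF A c]])
    fix y y' assume "(1 / c) *\<^sub>R (w - y) \<in> A y" "(1 / c) *\<^sub>R (w - y') \<in> A y'"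
    from maximally_monotone_monotone[OF A this]
    also have "(1 / c) *\<^sub>R (w - y) - (1 / c) *\<^sub>R (w - y') = (- (1 / c)) *\<^sub>R (y - y')"
      by (simp add: algebra_simps)
    also have "(y - y') \<bullet> \<dots> = - ((norm (y - y'))\<^sup>2 / c)"
      by (simp only: inner_scaleR_right power2_norm_eq_inner) simp
    finally show "y = y'" using c
      by (simp add: divide_le_0_iff)
  qed
  from theI'[OF this] show ?thesis unfolding resolvent_def[symmetric] by (simp only: eq)
qed

text \<open>The equation says that \<open>s\<close> is the resolvent of \<open>c A\<close> at
  \<open>w - c F s\<close>. As resolvents are nonexpansive, this is a fixed-point equation for a
  contraction with constant \<open>c K\<close>. It supplies the test points in
  \<open>cluster_fixpoint\<close>.\<close>

lemma perturbed_resolvent_exists: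
  fixes A :: "'a::{real_inner,complete_space} \<Rightarrow> 'a set"
  assumes A: "maximally_monotone A" and F: "\<And>u v. norm (F u - F v) \<le> K * norm (u - v)"
    and c: "0 < c" "0 \<le> K" "c * K < 1"
  shows "\<exists>s. \<exists>t\<in>A s. s + c *\<^sub>R (t + F s) = w"
proof -
  obtain R where R: "\<And>w. (1 / c) *\<^sub>R (w - R w) \<in> A (R w)"
    using Minty[OF A c(1)] by metis
  have nonexp: "norm (R w - R w') \<le> norm (w - w')" for w w'
  proof -
    have "0 \<le> (R w - R w') \<bullet> ((1 / c) *\<^sub>R (w - R w) - (1 / c) *\<^sub>R (w' - R w'))"
      by (rule maximally_monotone_monotone[OF A R R])
    also have "\<dots> = (1 / c) * ((R w - R w') \<bullet> (w - w') - (norm (R w - R w'))\<^sup>2)"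
      unfolding scaleR_diff_right[symmetric] inner_scaleR_right
      by (simp add: power2_norm_eq_inner inner_simps)
    finally have "(norm (R w - R w'))\<^sup>2 \<le> (R w - R w') \<bullet> (w - w')"
      using c(1) by (simp add: zero_le_divide_iff)
    also have "\<dots> \<le> norm (R w - R w') * norm (w - w')" by (rule norm_cauchy_schwarz)
    finally have "norm (R w - R w') * norm (R w - R w') \<le> norm (R w - R w') * norm (w - w')"
      by (simp add: power2_eq_square)
    then show ?thesis by (cases "R w = R w'") (auto simp: mult_le_cancel_left)
  qed
  have "\<exists>!s. R (w - c *\<^sub>R F s) = s"
  proof (rule banach_fix_type[of "c * K"]; (intro allI)?)
    show "dist (R (w - c *\<^sub>R F s)) (R (w - c *\<^sub>R F s')) \<le> c * K * dist s s'" for s s'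
    proof -
      have "dist (R (w - c *\<^sub>R F s)) (R (w - c *\<^sub>R F s')) \<le> norm (c *\<^sub>R (F s' - F s))"
        unfolding dist_norm by (rule order_trans[OF nonexp]) (simp add: algebra_simps)
      also have "\<dots> \<le> c * (K * norm (s' - s))" using c(1) F by simp
      finally show ?thesis by (simp add: dist_norm norm_minus_commute)
    qed
  qed (use c in auto)
  then obtain s where s: "R (w - c *\<^sub>R F s) = s" by blast
  have "(1 / c) *\<^sub>R (w - c *\<^sub>R F s - s) \<in> A s" using R[of "w - c *\<^sub>R F s"] unfolding s .
  moreover have "s + c *\<^sub>R ((1 / c) *\<^sub>R (w - c *\<^sub>R F s - s) + F s) = w"
    using c(1) by (simp add: scaleR_add_right)
  ultimately show ?thesis by blast
qed

subsection \<open>Weak cluster points of tuples\<close>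

text \<open>A substitute for weak sequential compactness: the half-spaces that eventually contain the tuples
  \<open>z k\<close>, \<open>k \<in> S\<close>, have a common point.  It is the limit of almost minimal-norm
  elements of the closed convex hulls of the tails.\<close>

lemma weak_cluster_tuple:
  fixes z :: "'i \<Rightarrow> nat \<Rightarrow> 'a::{real_inner,complete_space}"
  assumes I: "finite I" and bd: "\<And>k. (\<Sum>i\<in>I. (norm (z i k))\<^sup>2) \<le> M" and S: "infinite S"
  shows "\<exists>\<zeta>. \<forall>g c. eventually (\<lambda>k. k \<in> S \<longrightarrow> c \<le> (\<Sum>i\<in>I. z i k \<bullet> g i)) sequentially \<longrightarrow>
            c \<le> (\<Sum>i\<in>I. \<zeta> i \<bullet> g i)"
proof -
  define \<delta> where "\<delta> n = inverse (real (Suc n))" for n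
  have \<delta>_pos: "0 < \<delta> n" for n by (simp add: \<delta>_def)
  have \<delta>_mono: "\<delta> l \<le> \<delta> n" if "n \<le> l" for n l using that by (simp add: \<delta>_def)
  have \<delta>_small: "\<exists>n. \<delta> n < e" if "0 < e" for e
    using reals_Archimedean[OF that] by (simp add: \<delta>_def)
  \<comment> \<open>The closed convex hull of a tail, encoded by the half-spaces that contain the
    tail; only the components in \<open>I\<close> matter.\<close>
  define H where "H n = {u. \<forall>g c. (\<forall>k\<in>S. n \<le> k \<longrightarrow> c \<le> (\<Sum>i\<in>I. z i k \<bullet> g i)) \<longrightarrow>
    c \<le> (\<Sum>i\<in>I. u i \<bullet> g i)}" for n
  define Q where "Q u = (\<Sum>i\<in>I. (norm (u i))\<^sup>2)" for u :: "'i \<Rightarrow> 'a"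
  define N where "N n = Inf (Q ` H n)" for n
  have Q0: "0 \<le> Q u" for u by (simp add: Q_def sum_nonneg)
  have bdd: "bdd_below (Q ` H n)" for n using Q0 by (auto intro!: bdd_belowI[where m=0])
  have zH: "(\<lambda>i. z i k) \<in> H n" if "k \<in> S" "n \<le> k" for k n using that by (auto simp: H_def)
  have "\<exists>k\<in>S. n \<le> k" for n using S by (meson infinite_nat_iff_unbounded_le)
  then have ne: "H n \<noteq> {}" and NM: "N n \<le> M" for n
  proof -
    obtain k where k: "k \<in> S" "n \<le> k" using \<open>\<And>n. \<exists>k\<in>S. n \<le> k\<close> by blast
    show "H n \<noteq> {}" using zH[OF k] by blast
    have "N n \<le> Q (\<lambda>i. z i k)" unfolding N_def by (rule cINF_lower[OF bdd zH[OF k]])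
    with bd[of k] show "N n \<le> M" by (simp add: Q_def)
  qed
  have Hmono: "H l \<subseteq> H n" if "n \<le> l" for n l
    using that unfolding H_def by (auto intro: order_trans)
  have Nle: "N n \<le> Q u" if "u \<in> H n" for n u
    unfolding N_def by (rule cINF_lower[OF bdd that])
  have Nmono: "incseq N"
    unfolding incseq_def N_def by (intro allI impI cINF_superset_mono ne bdd Hmono) auto
  have "\<exists>u\<in>H n. Q u < N n + \<delta> n" for n
    using cInf_lessD[of "Q ` H n" "N n + \<delta> n"] ne \<delta>_pos by (auto simp: N_def)
  then obtain u where uH: "\<And>n. u n \<in> H n" and uQ: "\<And>n. Q (u n) < N n + \<delta> n"
    by metis
  \<comment> \<open>The hulls shrink, so \<open>u l\<close> lies in \<open>H n\<close> too and the
    midpoint has squared norm at least \<open>N n\<close>. The distance is thus governed by the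
    growth of \<open>N\<close>, which is increasing and bounded.\<close>
  have mid: "Q (\<lambda>i. u n i - u l i) \<le> 2 * (N l - N n) + 4 * \<delta> n" if nl: "n \<le> l" for n l
  proof -
    have "(\<lambda>i. (1/2) *\<^sub>R (u n i + u l i)) \<in> H n"
    proof (unfold H_def mem_Collect_eq, intro allI impI)
      fix g c assume *: "\<forall>k\<in>S. n \<le> k \<longrightarrow> c \<le> (\<Sum>i\<in>I. z i k \<bullet> g i)"
      have "c \<le> (\<Sum>i\<in>I. u n i \<bullet> g i)" using uH[of n] * unfolding H_def by blast
      moreover have "c \<le> (\<Sum>i\<in>I. u l i \<bullet> g i)" using Hmono[OF nl] uH[of l] * unfolding H_def by blast
      ultimately show "c \<le> (\<Sum>i\<in>I. ((1/2) *\<^sub>R (u n i + u l i)) \<bullet> g i)"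
        by (simp add: inner_simps sum.distrib sum_distrib_left[symmetric] sum_divide_distrib[symmetric] add_divide_distrib)
    qed
    from Nle[OF this] have 1: "N n \<le> Q (\<lambda>i. (1/2) *\<^sub>R (u n i + u l i))" .
    have "Q (\<lambda>i. u n i - u l i) = 2 * Q (u n) + 2 * Q (u l) - 4 * Q (\<lambda>i. (1/2) *\<^sub>R (u n i + u l i))"
      unfolding Q_def midpoint_sq sum.distrib sum_subtractf sum_distrib_left ..
    moreover have "\<delta> l \<le> \<delta> n" using nl by (rule \<delta>_mono)
    ultimately show ?thesis using 1 uQ[of n] uQ[of l] by argo
  qed
  have "convergent N" using Nmono NM by (metis incseq_convergent convergentI)
  then have CN: "Cauchy N" by (simp add: Cauchy_convergent_iff)
  have "convergent (\<lambda>n. u n i)" if i: "i \<in> I" for i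
  proof -
    have "Cauchy (\<lambda>n. u n i)"
      unfolding Cauchy_altdef
    proof (intro allI impI)
      fix e :: real assume e: "0 < e"
      then have e4: "0 < e\<^sup>2 / 8" by simp
      obtain M1 where M1: "\<And>n l. n \<ge> M1 \<Longrightarrow> l \<ge> M1 \<Longrightarrow> \<bar>N l - N n\<bar> < e\<^sup>2 / 8"
        using metric_CauchyD[OF CN e4] by (metis dist_real_def)
      obtain M2 where M2: "\<delta> M2 < e\<^sup>2 / 8"
        using \<delta>_small[OF e4] by blast
      have "dist (u n i) (u l i) < e" if n: "n \<ge> max M1 M2" and l: "n < l" for n l
      proof -
        have "\<delta> n \<le> \<delta> M2" using n by (simp add: \<delta>_mono)
        moreover have "(norm (u n i - u l i))\<^sup>2 \<le> Q (\<lambda>i. u n i - u l i)"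
          unfolding Q_def by (rule member_le_sum[OF i _ I]) auto
        moreover have "\<bar>N l - N n\<bar> < e\<^sup>2 / 8" using M1 n l by simp
        ultimately have "(norm (u n i - u l i))\<^sup>2 < e\<^sup>2"
          using mid[OF less_imp_le[OF l]] M2 unfolding abs_less_iff by argo
        then show ?thesis using e by (simp add: dist_norm power2_less_imp_less)
      qed
      then show "\<exists>M. \<forall>m\<ge>M. \<forall>n>m. dist (u m i) (u n i) < e" by blast
    qed
    then show ?thesis by (simp add: Cauchy_convergent_iff)
  qed
  then obtain \<zeta> where \<zeta>: "\<And>i. i \<in> I \<Longrightarrow> (\<lambda>n. u n i) \<longlonglongrightarrow> \<zeta> i"
    unfolding convergent_def by metis
  show ?thesis
  proof (intro exI[of _ \<zeta>] allI impI)
    fix g c assume "\<forall>\<^sub>F k in sequentially. k \<in> S \<longrightarrow> c \<le> (\<Sum>i\<in>I. z i k \<bullet> g i)"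
    then obtain n where n: "\<forall>k\<in>S. n \<le> k \<longrightarrow> c \<le> (\<Sum>i\<in>I. z i k \<bullet> g i)"
      unfolding eventually_sequentially by blast
    have "(\<lambda>l. \<Sum>i\<in>I. u l i \<bullet> g i) \<longlonglongrightarrow> (\<Sum>i\<in>I. \<zeta> i \<bullet> g i)"
      by (intro tendsto_intros \<zeta>)
    moreover have "c \<le> (\<Sum>i\<in>I. u l i \<bullet> g i)" if "l \<ge> n" for l
      using Hmono[OF that] uH[of l] n unfolding H_def by blast
    ultimately show "c \<le> (\<Sum>i\<in>I. \<zeta> i \<bullet> g i)"
      by (intro LIMSEQ_le_const) auto
  qed
qed

subsection \<open>Elementary inequalities\<close>

lemma two_inner_diff:
  fixes a b :: "'a::real_inner"
  shows "2 * ((a - b) \<bullet> a) = (norm a)\<^sup>2 - (norm b)\<^sup>2 + (norm (a - b))\<^sup>2"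
  by (simp add: power2_norm_eq_inner inner_simps inner_commute)

text \<open>\<open>c\<close> stands for \<open>C u - C p\<close> but is paired with a point
  \<open>w\<close> other than \<open>u\<close>. In the square of \<open>w - u + 2 \<beta> c\<close>
  cocoercivity absorbs the term quadratic in \<open>c\<close>, so only the distance from
  \<open>w\<close> to \<open>u\<close> remains.\<close>

lemma cocoercive_lower_bound:
  fixes c :: "'a::real_inner"
  assumes "\<beta> * (norm c)\<^sup>2 \<le> (u - p) \<bullet> c" "0 < \<beta>"
  shows "- ((w - p) \<bullet> c) \<le> (norm (w - u))\<^sup>2 / (4 * \<beta>)"
proof -
  have "0 \<le> (norm ((w - u) + (2 * \<beta>) *\<^sub>R c))\<^sup>2" by simp
  also have "\<dots> = (norm (w - u))\<^sup>2 + 4 * \<beta> * ((w - u) \<bullet> c) + 4 * \<beta> * (\<beta> * (norm c)\<^sup>2)"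
    unfolding power2_norm_eq_inner inner_add_left inner_add_right inner_scaleR_left inner_scaleR_right
    by (simp add: inner_commute[of c w] inner_commute[of c u] algebra_simps)
  also have "\<dots> \<le> (norm (w - u))\<^sup>2 + 4 * \<beta> * ((w - u) \<bullet> c) + 4 * \<beta> * ((u - p) \<bullet> c)"
    using assms by (intro add_left_mono mult_left_mono) auto
  also have "\<dots> = (norm (w - u))\<^sup>2 + 4 * \<beta> * ((w - p) \<bullet> c)"
    by (simp add: inner_simps algebra_simps)
  finally show ?thesis using assms(2) by (simp add: field_simps)
qed

lemma cocoercive_lipschitz:
  assumes "cocoercive \<beta> C" "0 < \<beta>"
  shows "norm (C u - C v) \<le> norm (u - v) / \<beta>"
proof (cases "C u = C v")
  case False
  have "\<beta> * (norm (C u - C v))\<^sup>2 \<le> norm (u - v) * norm (C u - C v)"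
    using assms(1) norm_cauchy_schwarz[of "u - v" "C u - C v"] unfolding cocoercive_def
    by (meson order_trans)
  with False have "\<beta> * norm (C u - C v) \<le> norm (u - v)" by (simp add: power2_eq_square)
  with assms(2) show ?thesis by (simp add: field_simps)
qed (use assms in simp)

lemma two_mult_le_squares:
  fixes a b :: real
  shows "2 * (a * b) \<le> a\<^sup>2 + b\<^sup>2"
  using sum_squares_bound[of a b] by simp

lemma inner_tendsto_zero:
  fixes e b :: "nat \<Rightarrow> 'a::real_inner"
  assumes "e \<longlonglongrightarrow> 0" "Bseq b"
  shows "(\<lambda>n. e n \<bullet> b n) \<longlonglongrightarrow> 0"
  using bounded_bilinear.Zfun_prod_Bfun[OF bounded_bilinear_inner, of e sequentially b] assms
  by (simp add: tendsto_Zfun_iff)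

text \<open>Here \<open>t\<close> is \<open>\<gamma> * L\<close>, \<open>k\<close> is
  \<open>\<gamma> / \<beta>\<close>, and \<open>q2 + X\<close>, \<open>Q + X\<close> are the
  splittings in \<open>dz_eq\<close> and \<open>dy_eq\<close>. In \<open>e1\<close> plus
  \<open>3/4\<close> of \<open>e2\<close> the coefficients of \<open>Q + X\<close>,
  \<open>d1\<close>, \<open>d0\<close> are \<open>9/4 t + 5/4 k\<close>,
  \<open>13/2 t + 3/4 k\<close>, \<open>7/4 t\<close>, with total \<open>2 k + 21/2 t\<close>. Their
  tail sums are the weights of \<open>d1\<close> and \<open>d0\<close>, which makes these terms
  telescope.\<close>

lemma lyapunov_decrease_arith:
  fixes t k g Z1 Z2 P1 P2 Q X q1 q2 d0 d1 dz0 :: real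
  assumes e1: "Z2 + (q2 + X) \<le> Z1 + 2 * g * P1 - 2 * g * P2 + t * (5 * d1 + d0) + k / 2 * (Q + X)"
    and e2: "(q2 + X) + Q \<le> dz0 + t * (3 * (Q + X) + 2 * d1 + d0) + k * ((Q + X) + d1)"
    and Q: "Q \<le> 2 * q2 + 2 * q1" and pos: "0 \<le> X" "0 \<le> 2 * k + 21/2 * t" "2 * k + 21/2 * t \<le> 1"
  shows "Z2 + 2 * g * P2 + 3/4 * (q2 + X) + (2 * k + 21/2 * t) / 2 * q2 + (33/4 * t + 3/4 * k) * (Q + X) + 7/4 * t * d1
      + (1 - (2 * k + 21/2 * t)) * q2 + 3/4 * (1 - (2 * k + 21/2 * t)) * (Q + X)
    \<le> Z1 + 2 * g * P1 + 3/4 * dz0 + (2 * k + 21/2 * t) / 2 * q1 + (33/4 * t + 3/4 * k) * d1 + 7/4 * t * d0"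
    (is "?l \<le> ?r")
proof -
  define s where "s = 2 * k + 21/2 * t"
  \<comment> \<open>The two estimates with weights 1 and \<open>3/4\<close>, the fraction
    \<open>s\<close> of \<open>q2\<close> traded for \<open>Q / 4\<close>, and a surplus in
    \<open>X\<close> account exactly for the difference of the two sides.\<close>
  have "0 \<le> (Z1 + 2 * g * P1 - 2 * g * P2 + t * (5 * d1 + d0) + k / 2 * (Q + X) - (Z2 + (q2 + X)))
    + 3/4 * (dz0 + t * (3 * (Q + X) + 2 * d1 + d0) + k * ((Q + X) + d1) - ((q2 + X) + Q))
    + s / 4 * (2 * q2 + 2 * q1 - Q) + 1/4 * ((1 - s) * X)"
    using e1 e2 Q pos unfolding s_def[symmetric] by (intro add_nonneg_nonneg mult_nonneg_nonneg) simp_all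
  also have "\<dots> = ?r - ?l" unfolding s_def by (simp add: field_simps)
  finally show ?thesis by (simp only: diff_ge_0_iff_ge)
qed

text \<open>\<open>P\<close> stands for the cross term \<open>2 * \<gamma> * \<Phi> p n\<close>,
  which has no sign. Its negative part costs at most half of \<open>Z\<close>, and the weights of
  the other squares cover the rest.\<close>

lemma lyapunov_lower_bound_arith:
  fixes t k P Z Q d0 d1 dz0 :: real
  assumes P: "- P \<le> t * (4 * d1 + d0 + dz0 + Z)" and pos: "0 \<le> t" "t \<le> 1/2" "0 \<le> k"
    "0 \<le> d0" "0 \<le> d1" "0 \<le> dz0" "0 \<le> Z" "0 \<le> Q"
  shows "Z / 2 \<le> Z + P + 3/4 * dz0 + (2 * k + 21/2 * t) / 2 * Q + (33/4 * t + 3/4 * k) * d1 + 7/4 * t * d0"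
    (is "?l \<le> ?r")
proof -
  have "0 \<le> (t * (4 * d1 + d0 + dz0 + Z) - (- P)) + (2 * k + 21/2 * t) / 2 * Q + (17/4 * t + 3/4 * k) * d1
      + 3/4 * t * d0 + (1/2 - t) * Z + (3/4 - t) * dz0"
    using P pos by (intro add_nonneg_nonneg mult_nonneg_nonneg) simp_all
  also have "\<dots> = ?r - ?l" by (simp add: field_simps)
  finally show ?thesis by (simp only: diff_ge_0_iff_ge)
qed

lemma tendsto_zero_of_mult_le:
  fixes u v :: "nat \<Rightarrow> real"
  assumes "v \<longlonglongrightarrow> 0" "0 < c" and u: "\<And>n. 0 \<le> u n" and le: "\<And>n. c * u n \<le> v n"
  shows "u \<longlonglongrightarrow> 0"
proof (rule tendsto_sandwich[OF _ _ tendsto_const, of _ _ _ "\<lambda>n. v n / c"])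
  show "(\<lambda>n. v n / c) \<longlonglongrightarrow> 0"
    using tendsto_divide_zero[OF assms(1)] .
  show "\<forall>\<^sub>F n in sequentially. u n \<le> v n / c"
    using le \<open>0 < c\<close> by (intro always_eventually allI) (simp add: field_simps)
qed (simp add: u)

text \<open>The hypothesis reads \<open>5 k + 10 t + 6 / a * t < 1\<close>. For
  \<open>a \<le> 12\<close> the last term is at least \<open>t / 2\<close>. For larger
  \<open>a\<close> the defining equation of \<open>a\<close> turns the same bound into one that
  makes \<open>t\<close> small.\<close>

lemma step_size_bound:
  fixes \<beta> L \<gamma> a :: real
  assumes L: "L > 0" and \<beta>: "\<beta> > 0"
    and a: "a = (17 * \<beta> * L + 10 + sqrt ((17 * \<beta> * L + 10)\<^sup>2 + 144 * \<beta>\<^sup>2 * L\<^sup>2)) / (6 * \<beta> * L)"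
    and \<gamma>: "0 < \<gamma>" "\<gamma> < \<beta> / (5 + (10 + 6 / a) * \<beta> * L)"
  shows "2 * (\<gamma> / \<beta>) + 21/2 * (\<gamma> * L) < 1"
proof -
  define b where "b = \<beta> * L"
  define k t where "k = \<gamma> / \<beta>" and "t = \<gamma> * L"
  have b: "0 < b" using L \<beta> by (simp add: b_def)
  have kt: "0 < k" "0 < t" "t = b * k" using L \<beta> \<gamma> by (auto simp: k_def t_def b_def)
  define R where "R = sqrt ((17 * b + 10)\<^sup>2 + 144 * b\<^sup>2)"
  have "a = (17 * b + 10 + R) / (6 * b)"
    unfolding a R_def b_def by (simp only: power_mult_distrib mult.assoc)
  then have aR: "6 * b * a = 17 * b + 10 + R" using b by simp
  have R: "R\<^sup>2 = (17 * b + 10)\<^sup>2 + 144 * b\<^sup>2" "0 \<le> R" by (auto simp: R_def)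
  have "0 < 6 * b * a" unfolding aR using b R(2) by linarith
  then have a0: "0 < a" using b by (simp add: zero_less_mult_iff)
  \<comment> \<open>Squaring removes the root and exhibits \<open>a\<close> as a root of a quadratic
    polynomial.\<close>
  have "(6 * b * a - (17 * b + 10))\<^sup>2 = (17 * b + 10)\<^sup>2 + 144 * b\<^sup>2" unfolding aR using R by simp
  then have "(12 * b) * (3 * b * a * a) = (12 * b) * (17 * b * a + 10 * a + 12 * b)"
    by (simp add: power2_eq_square algebra_simps)
  then have quad: "3 * b * a * a = 17 * b * a + 10 * a + 12 * b" using b by simp
  have den: "0 < 5 + (10 + 6 / a) * b" using a0 b by (simp add: add_pos_nonneg)
  have "\<gamma> < \<beta> / (5 + (10 + 6 / a) * b)" using \<gamma>(2) by (simp add: b_def mult.assoc)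
  then have "\<gamma> * (5 + (10 + 6 / a) * b) < \<beta>" using den by (simp add: field_simps)
  then have "k * (5 + (10 + 6 / a) * b) < 1" using \<beta> unfolding k_def by (simp add: field_simps)
  then have main: "5 * k + 10 * t + 6 / a * t < 1" unfolding kt(3) by (simp add: algebra_simps)
  show ?thesis unfolding k_def[symmetric] t_def[symmetric]
  proof (cases "a \<le> 12")
    case True
    then have "1/2 \<le> 6 / a" using a0 by (simp add: field_simps)
    then have "1/2 * t \<le> 6 / a * t" using kt(2) by (intro mult_right_mono) auto
    with main kt(1) show "2 * k + 21/2 * t < 1" by linarith
  next
    case False
    \<comment> \<open>The value of \<open>a\<close> balances two constraints: the bound on \<open>\<gamma>\<close> is also \<open>2 / (3 (a + 1) L)\<close>.\<close>
    have "3 * b * a = 17 * b + 10 + 12 / a * b" using quad a0 by (simp add: field_simps)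
    then have "k * (3 * b * a) = k * (17 * b + 10 + 12 / a * b)" by simp
    then have "3 * (t * a) = 17 * t + 10 * k + 12 / a * t" unfolding kt(3) by (simp add: algebra_simps)
    moreover have "12 / a * t = 2 * (6 / a * t)" by simp
    ultimately have "3 * (t * a) + 3 * t < 2" using main by linarith
    moreover have "12 * t \<le> t * a" using False kt(2) by simp
    moreover have "0 < 6 / a * t" using a0 kt(2) by simp
    \<comment> \<open>These facts give \<open>39 t < 2\<close> and \<open>5 k < 1 - 10 t\<close>,
      hence \<open>2 k + 21/2 t < 2/5 + 13/2 t < 2/5 + 1/3\<close>.\<close>
    ultimately show "2 * k + 21/2 * t < 1" using main kt by linarith
  qed
qed

subsection \<open>The Lyapunov function of the iteration\<close>

text \<open>The index of \<open>y\<close> is shifted by one, so that the starting value with index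
  -1 is \<open>y i 0\<close>. In \<open>y_step\<close> the resolvent is replaced by its inclusion,
  and the \<open>z\<close> update has been used to write \<open>2 x - z - y\<close> as
  \<open>x\<close> minus the new \<open>z\<close>.\<close>

locale splitting_iteration =
  fixes I :: "'i set" and A :: "'i \<Rightarrow> 'a::{real_inner,complete_space} \<Rightarrow> 'a set"
    and B C :: "'a \<Rightarrow> 'a" and \<omega> :: "'i \<Rightarrow> real" and L \<beta> \<gamma> :: real
    and x :: "nat \<Rightarrow> 'a" and y z :: "'i \<Rightarrow> nat \<Rightarrow> 'a"
  assumes finite_I: "finite I"
    and \<omega>_pos: "\<And>i. i \<in> I \<Longrightarrow> 0 < \<omega> i" and \<omega>_sum: "sum \<omega> I = 1"
    and A: "\<And>i. i \<in> I \<Longrightarrow> maximally_monotone (A i)"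
    and B_mono: "monotone_fun B" and B_lip: "\<And>u v. norm (B u - B v) \<le> L * norm (u - v)"
    and C_coco: "cocoercive \<beta> C"
    and L_pos: "0 < L" and \<beta>_pos: "0 < \<beta>" and \<gamma>_pos: "0 < \<gamma>"
    and small: "2 * (\<gamma> / \<beta>) + 21/2 * (\<gamma> * L) < 1"
    and x_step: "\<And>n. x (Suc n) = (\<Sum>i\<in>I. \<omega> i *\<^sub>R z i n)"
    and z_step: "\<And>i n. i \<in> I \<Longrightarrow> z i (Suc n) = z i n + y i (Suc (Suc n)) - x (Suc n)"
    and y_step: "\<And>i n. i \<in> I \<Longrightarrow>
      (\<omega> i / \<gamma>) *\<^sub>R (x (Suc n) - z i (Suc n) - \<gamma> *\<^sub>R B (2 *\<^sub>R y i (Suc n) - y i n) - \<gamma> *\<^sub>R C (y i (Suc n)))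
      \<in> A i (y i (Suc (Suc n)))"
begin

text \<open>The squared norm of the product space; in this norm the weighted mean is the orthogonal
  projection onto the diagonal.\<close>

definition wsq :: "('i \<Rightarrow> 'a) \<Rightarrow> real" where
  "wsq u = (\<Sum>i\<in>I. \<omega> i * (norm (u i))\<^sup>2)"

text \<open>The tuple \<open>\<zeta>\<close> encodes a zero \<open>p\<close> together with the elements of \<open>A i p\<close> that
  certify it.\<close>

definition fixpoint :: "'a \<Rightarrow> ('i \<Rightarrow> 'a) \<Rightarrow> bool" where
  "fixpoint p \<zeta> \<longleftrightarrow> (\<Sum>i\<in>I. \<omega> i *\<^sub>R \<zeta> i) = p \<and>
     (\<forall>i\<in>I. (\<omega> i / \<gamma>) *\<^sub>R (p - \<zeta> i - \<gamma> *\<^sub>R B p - \<gamma> *\<^sub>R C p) \<in> A i p)"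

abbreviation r :: "'i \<Rightarrow> nat \<Rightarrow> 'a" where "r i n \<equiv> 2 *\<^sub>R y i (Suc n) - y i n"

text \<open>The component of the increment of \<open>z\<close> that is orthogonal to the diagonal of the product space.\<close>

definition q :: "nat \<Rightarrow> 'i \<Rightarrow> 'a" where
  "q n i = (z i (Suc n) - z i n) - (x (Suc (Suc n)) - x (Suc n))"

definition dy :: "nat \<Rightarrow> real" where "dy n = wsq (\<lambda>i. y i (Suc n) - y i n)"
definition dz :: "nat \<Rightarrow> real" where "dz n = wsq (\<lambda>i. z i (Suc n) - z i n)"
text \<open>The cross term left over from evaluating \<open>B\<close> at reflected points; in
  \<open>fejer_estimate\<close> it occurs at two consecutive indices and telescopes.\<close>

definition \<Phi> :: "'a \<Rightarrow> nat \<Rightarrow> real" where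
  "\<Phi> p n = (\<Sum>i\<in>I. \<omega> i * ((y i (Suc (Suc n)) - y i (Suc n)) \<bullet> (B (r i n) - B p)))"

section \<open>Weighted means and the orthogonal splitting along the diagonal\<close>

lemma wsum_mono: "(\<And>i. i \<in> I \<Longrightarrow> f i \<le> g i) \<Longrightarrow> (\<Sum>i\<in>I. \<omega> i * f i) \<le> (\<Sum>i\<in>I. \<omega> i * g i)"
  using \<omega>_pos by (intro sum_mono mult_left_mono) (auto simp: less_imp_le)

lemma wsum_inner: "(\<Sum>i\<in>I. \<omega> i * (v \<bullet> u i)) = v \<bullet> (\<Sum>i\<in>I. \<omega> i *\<^sub>R u i)"
  by (simp add: inner_sum_right)

lemma wsum_const: "(\<Sum>i\<in>I. \<omega> i * c) = c"
  by (simp add: sum_distrib_right[symmetric] \<omega>_sum)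

lemma wsum_const_vec: "(\<Sum>i\<in>I. \<omega> i *\<^sub>R c) = (c :: 'a)"
  by (simp add: scaleR_sum_left[symmetric] \<omega>_sum)

lemma wsq_nonneg: "0 \<le> wsq u"
  unfolding wsq_def using \<omega>_pos by (intro sum_nonneg) (auto simp: less_imp_le)

text \<open>Pythagoras for the projection onto the diagonal.\<close>

lemma wsq_mean:
  assumes "(\<Sum>i\<in>I. \<omega> i *\<^sub>R u i) = v"
  shows "wsq u = wsq (\<lambda>i. u i - v) + (norm v)\<^sup>2"
proof -
  have "wsq (\<lambda>i. u i - v) = wsq u - 2 * (\<Sum>i\<in>I. \<omega> i * (v \<bullet> u i)) + (\<Sum>i\<in>I. \<omega> i * (norm v)\<^sup>2)"
    unfolding wsq_def sum_distrib_left sum_subtractf[symmetric] sum.distrib[symmetric]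
    by (intro sum.cong refl) (simp add: power2_norm_eq_inner inner_simps inner_commute algebra_simps)
  then show ?thesis
    unfolding wsum_inner assms wsum_const by (simp add: power2_norm_eq_inner)
qed

lemma wsq_add_mean_zero:
  assumes "(\<Sum>i\<in>I. \<omega> i *\<^sub>R u i) = 0"
  shows "wsq (\<lambda>i. u i + v) = wsq u + (norm v)\<^sup>2"
  using wsq_mean[of "\<lambda>i. u i + v" v] assms
  by (simp add: scaleR_add_right sum.distrib wsum_const_vec)

lemma wsq_diff_le: "wsq (\<lambda>i. u i - v i) \<le> 2 * wsq u + 2 * wsq v"
proof -
  have "wsq (\<lambda>i. u i - v i) \<le> (\<Sum>i\<in>I. \<omega> i * (2 * (norm (u i))\<^sup>2 + 2 * (norm (v i))\<^sup>2))"
    unfolding wsq_def by (intro wsum_mono) (simp add: midpoint_sq)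
  also have "\<dots> = 2 * wsq u + 2 * wsq v"
    unfolding wsq_def sum_distrib_left sum.distrib[symmetric]
    by (intro sum.cong refl) (simp add: algebra_simps)
  finally show ?thesis .
qed

lemma wsq_cong: "(\<And>i. i \<in> I \<Longrightarrow> u i = v i) \<Longrightarrow> wsq u = wsq v"
  by (simp add: wsq_def)

lemma sum_y: "(\<Sum>i\<in>I. \<omega> i *\<^sub>R y i (Suc (Suc n))) = x (Suc (Suc n))"
proof -
  have "(\<Sum>i\<in>I. \<omega> i *\<^sub>R y i (Suc (Suc n))) =
      (\<Sum>i\<in>I. \<omega> i *\<^sub>R z i (Suc n) - \<omega> i *\<^sub>R z i n + \<omega> i *\<^sub>R x (Suc n))"
    by (intro sum.cong refl) (simp add: z_step algebra_simps)
  then show ?thesis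
    by (simp add: sum.distrib sum_subtractf wsum_const_vec x_step[symmetric])
qed

lemma sum_dz: "(\<Sum>i\<in>I. \<omega> i *\<^sub>R (z i (Suc n) - z i n)) = x (Suc (Suc n)) - x (Suc n)"
  by (simp add: scaleR_diff_right sum_subtractf x_step[symmetric])

lemma sum_q: "(\<Sum>i\<in>I. \<omega> i *\<^sub>R q n i) = 0"
  unfolding q_def scaleR_diff_right[of _ "z _ _ - z _ _"] sum_subtractf sum_dz wsum_const_vec by simp

lemma dz_eq: "dz n = wsq (q n) + (norm (x (Suc (Suc n)) - x (Suc n)))\<^sup>2"
  unfolding dz_def wsq_mean[OF sum_dz] q_def by simp

text \<open>The \<open>z\<close> update amounts to
  \<open>y i (Suc (Suc n)) = q n i + x (Suc (Suc n))\<close>, and \<open>q\<close> has mean zero, so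
  the two parts of the increment are orthogonal.\<close>

lemma dy_eq:
  "dy (Suc (Suc n)) = wsq (\<lambda>i. q (Suc n) i - q n i) + (norm (x (Suc (Suc (Suc n))) - x (Suc (Suc n))))\<^sup>2"
proof -
  have "dy (Suc (Suc n)) = wsq (\<lambda>i. (q (Suc n) i - q n i) + (x (Suc (Suc (Suc n))) - x (Suc (Suc n))))"
    unfolding dy_def by (intro wsq_cong) (simp add: q_def z_step)
  then show ?thesis
    by (simp add: wsq_add_mean_zero scaleR_diff_right sum_subtractf sum_q)
qed

section \<open>One-step estimates from monotonicity\<close>

lemma B_diff_bound:
  "e \<bullet> (B (r i (Suc n)) - B (r i n)) \<le>
     L * (2 * (norm e * norm (y i (Suc (Suc n)) - y i (Suc n))) + norm e * norm (y i (Suc n) - y i n))"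
proof -
  have "norm (B (r i (Suc n)) - B (r i n)) \<le> L * norm (r i (Suc n) - r i n)" by (rule B_lip)
  also have "r i (Suc n) - r i n = 2 *\<^sub>R (y i (Suc (Suc n)) - y i (Suc n)) - (y i (Suc n) - y i n)"
    by (simp add: algebra_simps)
  also have "norm \<dots> \<le> 2 * norm (y i (Suc (Suc n)) - y i (Suc n)) + norm (y i (Suc n) - y i n)"
    by (rule order_trans[OF norm_triangle_ineq4]) simp
  finally have "norm (B (r i (Suc n)) - B (r i n)) \<le>
      L * (2 * norm (y i (Suc (Suc n)) - y i (Suc n)) + norm (y i (Suc n) - y i n))"
    using L_pos by simp
  then have "norm e * norm (B (r i (Suc n)) - B (r i n)) \<le>
      norm e * (L * (2 * norm (y i (Suc (Suc n)) - y i (Suc n)) + norm (y i (Suc n) - y i n)))"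
    by (rule mult_left_mono) simp
  then show ?thesis
    using norm_cauchy_schwarz[of e "B (r i (Suc n)) - B (r i n)"] by (simp add: algebra_simps)
qed

text \<open>Monotonicity of \<open>A i\<close> between the newest iterate and \<open>p\<close>.
  Cocoercivity bounds the delayed \<open>C\<close> term, and monotonicity of \<open>B\<close> is
  used at the reflected point.\<close>

lemma fejer_estimate_pointwise:
  assumes p: "fixpoint p \<zeta>" and i: "i \<in> I"
  defines "d \<equiv> \<lambda>n. y i (Suc n) - y i n"
  shows "2 * ((y i (Suc (Suc (Suc n))) - p) \<bullet> (z i (Suc (Suc n)) - \<zeta> i - (x (Suc (Suc n)) - p))) \<le>
     2 * \<gamma> * (d (Suc n) \<bullet> (B (r i n) - B p)) - 2 * \<gamma> * (d (Suc (Suc n)) \<bullet> (B (r i (Suc n)) - B p))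
     + \<gamma> * L * (5 * (norm (d (Suc n)))\<^sup>2 + (norm (d n))\<^sup>2) + \<gamma> / \<beta> / 2 * (norm (d (Suc (Suc n))))\<^sup>2"
proof -
  define y3 where "y3 = y i (Suc (Suc (Suc n)))"
  define b where "b = B (r i (Suc n)) - B p"
  define c where "c = C (y i (Suc (Suc n))) - C p"
  define w where "w = z i (Suc (Suc n)) - \<zeta> i - (x (Suc (Suc n)) - p)"
  have "(\<omega> i / \<gamma>) *\<^sub>R (p - \<zeta> i - \<gamma> *\<^sub>R B p - \<gamma> *\<^sub>R C p) \<in> A i p"
    using p i unfolding fixpoint_def by blast
  from maximally_monotone_monotone[OF A[OF i] y_step[OF i, of "Suc n"] this]
  have "0 \<le> (\<omega> i / \<gamma>) * ((y3 - p) \<bullet> (- w - \<gamma> *\<^sub>R b - \<gamma> *\<^sub>R c))"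
    unfolding scaleR_diff_right[symmetric] inner_scaleR_right y3_def b_def c_def w_def
    by (simp add: algebra_simps)
  then have "0 \<le> (y3 - p) \<bullet> (- w - \<gamma> *\<^sub>R b - \<gamma> *\<^sub>R c)"
    using \<omega>_pos[OF i] \<gamma>_pos by (simp add: zero_le_mult_iff zero_le_divide_iff)
  then have 1: "(y3 - p) \<bullet> w \<le> \<gamma> * (- ((y3 - p) \<bullet> b)) + \<gamma> * (- ((y3 - p) \<bullet> c))"
    by (simp add: inner_diff_right)
  have "- ((y3 - p) \<bullet> c) \<le> (norm (d (Suc (Suc n))))\<^sup>2 / (4 * \<beta>)"
    using C_coco \<beta>_pos unfolding cocoercive_def c_def d_def y3_def by (intro cocoercive_lower_bound) auto
  then have "\<gamma> * (- ((y3 - p) \<bullet> c)) \<le> \<gamma> * ((norm (d (Suc (Suc n))))\<^sup>2 / (4 * \<beta>))"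
    using \<gamma>_pos by (intro mult_left_mono) auto
  then have 2: "\<gamma> * (- ((y3 - p) \<bullet> c)) \<le> \<gamma> / \<beta> / 4 * (norm (d (Suc (Suc n))))\<^sup>2"
    by (simp add: field_simps)
  have "0 \<le> (r i (Suc n) - p) \<bullet> b"
    using B_mono unfolding monotone_fun_def b_def by blast
  \<comment> \<open>The newest iterate differs from the reflected point by a difference of two
    consecutive increments.\<close>
  moreover have "(y3 - p) \<bullet> b = (r i (Suc n) - p) \<bullet> b + d (Suc (Suc n)) \<bullet> b - d (Suc n) \<bullet> b"
    unfolding inner_add_left[symmetric] inner_diff_left[symmetric] d_def y3_def
    by (simp add: algebra_simps scaleR_2)
  \<comment> \<open>Going back to the previous value of \<open>B\<close> makes this the predecessor
    of the other inner product; the error is a product of increments.\<close>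
  moreover have "d (Suc n) \<bullet> b = d (Suc n) \<bullet> (B (r i n) - B p) + d (Suc n) \<bullet> (B (r i (Suc n)) - B (r i n))"
    unfolding inner_add_right[symmetric] b_def by simp
  moreover have "d (Suc n) \<bullet> (B (r i (Suc n)) - B (r i n)) \<le> L * (5/2 * (norm (d (Suc n)))\<^sup>2 + (norm (d n))\<^sup>2 / 2)"
  proof (rule order_trans[OF B_diff_bound])
    show "L * (2 * (norm (d (Suc n)) * norm (y i (Suc (Suc n)) - y i (Suc n))) + norm (d (Suc n)) * norm (y i (Suc n) - y i n))
       \<le> L * (5/2 * (norm (d (Suc n)))\<^sup>2 + (norm (d n))\<^sup>2 / 2)"
      using two_mult_le_squares[of "norm (d (Suc n))" "norm (d n)"] L_pos
      unfolding d_def by (intro mult_left_mono) (auto simp: power2_eq_square)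
  qed
  ultimately have "- ((y3 - p) \<bullet> b) \<le> d (Suc n) \<bullet> (B (r i n) - B p) - d (Suc (Suc n)) \<bullet> b
      + L * (5/2 * (norm (d (Suc n)))\<^sup>2 + (norm (d n))\<^sup>2 / 2)" by linarith
  then have "\<gamma> * (- ((y3 - p) \<bullet> b)) \<le> \<gamma> * (d (Suc n) \<bullet> (B (r i n) - B p) - d (Suc (Suc n)) \<bullet> b
      + L * (5/2 * (norm (d (Suc n)))\<^sup>2 + (norm (d n))\<^sup>2 / 2))" 
    using \<gamma>_pos by (intro mult_left_mono) auto
  with 1 2 have "2 * ((y3 - p) \<bullet> w) \<le> 2 * \<gamma> * (d (Suc n) \<bullet> (B (r i n) - B p)) - 2 * \<gamma> * (d (Suc (Suc n)) \<bullet> b)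
     + \<gamma> * L * (5 * (norm (d (Suc n)))\<^sup>2 + (norm (d n))\<^sup>2) + \<gamma> / \<beta> / 2 * (norm (d (Suc (Suc n))))\<^sup>2"
    by (simp add: algebra_simps)
  then show ?thesis unfolding y3_def w_def b_def .
qed

text \<open>Monotonicity of \<open>A i\<close> between consecutive iterates. \<open>B\<close> and
  \<open>C\<close> enter through their Lipschitz constants, and products of different increments are
  split evenly into squares.\<close>

lemma increment_estimate_pointwise:
  assumes i: "i \<in> I"
  defines "d \<equiv> \<lambda>n. y i (Suc n) - y i n"
  shows "2 * (d (Suc (Suc n)) \<bullet> ((z i (Suc (Suc n)) - z i (Suc n)) - (x (Suc (Suc n)) - x (Suc n)))) \<le>
     \<gamma> * L * (3 * (norm (d (Suc (Suc n))))\<^sup>2 + 2 * (norm (d (Suc n)))\<^sup>2 + (norm (d n))\<^sup>2)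
     + \<gamma> / \<beta> * ((norm (d (Suc (Suc n))))\<^sup>2 + (norm (d (Suc n)))\<^sup>2)"
proof -
  define b where "b = B (r i (Suc n)) - B (r i n)"
  define c where "c = C (y i (Suc (Suc n))) - C (y i (Suc n))"
  define w where "w = (z i (Suc (Suc n)) - z i (Suc n)) - (x (Suc (Suc n)) - x (Suc n))"
  let ?d3 = "d (Suc (Suc n))" and ?d2 = "d (Suc n)" and ?d1 = "d n"
  from maximally_monotone_monotone[OF A[OF i] y_step[OF i, of "Suc n"] y_step[OF i, of n]]
  have "0 \<le> (\<omega> i / \<gamma>) * (?d3 \<bullet> (- w - \<gamma> *\<^sub>R b - \<gamma> *\<^sub>R c))"
    unfolding scaleR_diff_right[symmetric] inner_scaleR_right d_def b_def c_def w_def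
    by (simp add: algebra_simps)
  then have "0 \<le> ?d3 \<bullet> (- w - \<gamma> *\<^sub>R b - \<gamma> *\<^sub>R c)"
    using \<omega>_pos[OF i] \<gamma>_pos by (simp add: zero_le_mult_iff zero_le_divide_iff)
  then have 1: "?d3 \<bullet> w \<le> \<gamma> * ((- ?d3) \<bullet> b) + \<gamma> * (- (?d3 \<bullet> c))"
    by (simp add: inner_diff_right)
  have "(- ?d3) \<bullet> b \<le> L * (3/2 * (norm ?d3)\<^sup>2 + (norm ?d2)\<^sup>2 + (norm ?d1)\<^sup>2 / 2)"
    unfolding b_def
  proof (rule order_trans[OF B_diff_bound])
    show "L * (2 * (norm (- ?d3) * norm (y i (Suc (Suc n)) - y i (Suc n))) + norm (- ?d3) * norm (y i (Suc n) - y i n))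
       \<le> L * (3/2 * (norm ?d3)\<^sup>2 + (norm ?d2)\<^sup>2 + (norm ?d1)\<^sup>2 / 2)"
      using two_mult_le_squares[of "norm ?d3" "norm ?d2"] two_mult_le_squares[of "norm ?d3" "norm ?d1"] L_pos
      unfolding d_def by (intro mult_left_mono) (auto simp: norm_minus_commute)
  qed
  then have 2: "\<gamma> * ((- ?d3) \<bullet> b) \<le> \<gamma> * (L * (3/2 * (norm ?d3)\<^sup>2 + (norm ?d2)\<^sup>2 + (norm ?d1)\<^sup>2 / 2))"
    using \<gamma>_pos by (intro mult_left_mono) auto
  have "- (?d3 \<bullet> c) \<le> norm ?d3 * norm c"
    using norm_cauchy_schwarz[of "- ?d3" c] by simp
  also have "\<dots> \<le> norm ?d3 * (norm ?d2 / \<beta>)"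
    unfolding c_def d_def using cocoercive_lipschitz[OF C_coco \<beta>_pos] by (intro mult_left_mono) auto
  also have "\<dots> = (norm ?d3 * norm ?d2) / \<beta>" by simp
  also have "\<dots> \<le> (((norm ?d3)\<^sup>2 + (norm ?d2)\<^sup>2) / 2) / \<beta>"
    using two_mult_le_squares[of "norm ?d3" "norm ?d2"] \<beta>_pos by (intro divide_right_mono) auto
  finally have "\<gamma> * (- (?d3 \<bullet> c)) \<le> \<gamma> * ((((norm ?d3)\<^sup>2 + (norm ?d2)\<^sup>2) / 2) / \<beta>)"
    using \<gamma>_pos by (intro mult_left_mono) auto
  also have "\<dots> = \<gamma> / \<beta> / 2 * ((norm ?d3)\<^sup>2 + (norm ?d2)\<^sup>2)" by simp
  finally have "2 * (?d3 \<bullet> w) \<le> 2 * (\<gamma> * (L * (3/2 * (norm ?d3)\<^sup>2 + (norm ?d2)\<^sup>2 + (norm ?d1)\<^sup>2 / 2)))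
     + 2 * (\<gamma> / \<beta> / 2 * ((norm ?d3)\<^sup>2 + (norm ?d2)\<^sup>2))"
    using 1 2 by linarith
  also have "\<dots> = \<gamma> * L * (3 * (norm ?d3)\<^sup>2 + 2 * (norm ?d2)\<^sup>2 + (norm ?d1)\<^sup>2)
     + \<gamma> / \<beta> * ((norm ?d3)\<^sup>2 + (norm ?d2)\<^sup>2)"
    by (simp add: algebra_simps)
  finally show ?thesis unfolding w_def .
qed

text \<open>Summing the pointwise estimate works because the \<open>z\<close> increment is
  \<open>y - p\<close> minus the diagonal vector \<open>x - p\<close>, whose contribution cancels in
  the mean. Polarisation then produces the squared distances.\<close>

lemma fejer_estimate:
  assumes p: "fixpoint p \<zeta>"
  shows "wsq (\<lambda>i. z i (Suc (Suc n)) - \<zeta> i) + dz (Suc n) \<le> wsq (\<lambda>i. z i (Suc n) - \<zeta> i)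
     + 2 * \<gamma> * \<Phi> p n - 2 * \<gamma> * \<Phi> p (Suc n) + \<gamma> * L * (5 * dy (Suc n) + dy n) + \<gamma> / \<beta> / 2 * dy (Suc (Suc n))"
proof -
  let ?z1 = "\<lambda>i. z i (Suc n)" and ?z2 = "\<lambda>i. z i (Suc (Suc n))" and ?y3 = "\<lambda>i. y i (Suc (Suc (Suc n)))"
    and ?x2 = "x (Suc (Suc n))"
  have "(\<Sum>i\<in>I. \<omega> i * ((?z2 i - ?z1 i) \<bullet> (?z2 i - \<zeta> i))) - (\<Sum>i\<in>I. \<omega> i * ((?y3 i - p) \<bullet> (?z2 i - \<zeta> i - (?x2 - p))))
      = (\<Sum>i\<in>I. \<omega> i * ((?x2 - p) \<bullet> (\<zeta> i - ?z2 i + ?y3 i - p)))"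
    unfolding sum_subtractf[symmetric]
  proof (intro sum.cong refl)
    fix i assume i: "i \<in> I"
    have "?z2 i - ?z1 i = (?y3 i - p) - (?x2 - p)" using z_step[OF i, of "Suc n"] by simp
    then have "(?z2 i - ?z1 i) \<bullet> (?z2 i - \<zeta> i) - (?y3 i - p) \<bullet> (?z2 i - \<zeta> i - (?x2 - p)) =
        (?x2 - p) \<bullet> (\<zeta> i - ?z2 i + ?y3 i - p)"
      by (simp add: inner_simps inner_commute)
    then show "\<omega> i * ((?z2 i - ?z1 i) \<bullet> (?z2 i - \<zeta> i)) - \<omega> i * ((?y3 i - p) \<bullet> (?z2 i - \<zeta> i - (?x2 - p)))
      = \<omega> i * ((?x2 - p) \<bullet> (\<zeta> i - ?z2 i + ?y3 i - p))"
      unfolding right_diff_distrib[symmetric] by simp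
  qed
  also have "\<dots> = 0"
  proof -
    \<comment> \<open>The means of \<open>?z2\<close> and \<open>?y3\<close> are both the next
      \<open>x\<close>, and the mean of \<open>\<zeta>\<close> is \<open>p\<close>.\<close>
    have "(\<Sum>i\<in>I. \<omega> i *\<^sub>R (\<zeta> i - ?z2 i + ?y3 i - p)) = 0"
      using p sum_y[of "Suc n"] x_step[of "Suc (Suc n)"]
      by (simp add: fixpoint_def scaleR_diff_right scaleR_add_right sum.distrib sum_subtractf wsum_const_vec)
    then show ?thesis unfolding wsum_inner by simp
  qed
  finally have "2 * (\<Sum>i\<in>I. \<omega> i * ((?z2 i - ?z1 i) \<bullet> (?z2 i - \<zeta> i))) =
      (\<Sum>i\<in>I. \<omega> i * (2 * ((?y3 i - p) \<bullet> (?z2 i - \<zeta> i - (?x2 - p)))))"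
    by (simp add: sum_distrib_left mult.left_commute)
  also have "\<dots> \<le> (\<Sum>i\<in>I. \<omega> i * (2 * \<gamma> * ((y i (Suc (Suc n)) - y i (Suc n)) \<bullet> (B (r i n) - B p))
      - 2 * \<gamma> * ((?y3 i - y i (Suc (Suc n))) \<bullet> (B (r i (Suc n)) - B p))
      + \<gamma> * L * (5 * (norm (y i (Suc (Suc n)) - y i (Suc n)))\<^sup>2 + (norm (y i (Suc n) - y i n))\<^sup>2)
      + \<gamma> / \<beta> / 2 * (norm (?y3 i - y i (Suc (Suc n))))\<^sup>2))"
    by (intro wsum_mono fejer_estimate_pointwise[OF p])
  also have "\<dots> = 2 * \<gamma> * \<Phi> p n - 2 * \<gamma> * \<Phi> p (Suc n) + \<gamma> * L * (5 * dy (Suc n) + dy n) + \<gamma> / \<beta> / 2 * dy (Suc (Suc n))"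
    unfolding \<Phi>_def dy_def wsq_def sum_distrib_left distrib_left right_diff_distrib sum.distrib sum_subtractf
    by (simp only: mult.left_commute mult.assoc)
  also have "2 * (\<Sum>i\<in>I. \<omega> i * ((?z2 i - ?z1 i) \<bullet> (?z2 i - \<zeta> i))) =
      wsq (\<lambda>i. ?z2 i - \<zeta> i) - wsq (\<lambda>i. ?z1 i - \<zeta> i) + dz (Suc n)"
    unfolding wsq_def dz_def sum_distrib_left sum_subtractf[symmetric] sum.distrib[symmetric]
  proof (intro sum.cong refl)
    fix i
    show "2 * (\<omega> i * ((?z2 i - ?z1 i) \<bullet> (?z2 i - \<zeta> i))) =
      \<omega> i * (norm (?z2 i - \<zeta> i))\<^sup>2 - \<omega> i * (norm (?z1 i - \<zeta> i))\<^sup>2 + \<omega> i * (norm (?z2 i - ?z1 i))\<^sup>2"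
      using two_inner_diff[of "?z2 i - \<zeta> i" "?z1 i - \<zeta> i"]
      unfolding right_diff_distrib[symmetric] distrib_left[symmetric] mult.left_commute[of 2] by simp
  qed
  finally show ?thesis by argo
qed

text \<open>Polarisation expresses the growth of \<open>dz\<close> by second differences of
  \<open>z\<close>, which agree with increments of \<open>y\<close> up to a diagonal term. That term
  is harmless because \<open>q n\<close> has mean zero.\<close>

lemma increment_estimate:
  "dz (Suc n) + wsq (\<lambda>i. q (Suc n) i - q n i) \<le> dz n
     + \<gamma> * L * (3 * dy (Suc (Suc n)) + 2 * dy (Suc n) + dy n) + \<gamma> / \<beta> * (dy (Suc (Suc n)) + dy (Suc n))"
proof -
  let ?a = "\<lambda>i. z i (Suc (Suc n)) - z i (Suc n)" and ?b = "\<lambda>i. z i (Suc n) - z i n"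
    and ?e = "x (Suc (Suc n)) - x (Suc n)"
  let ?d = "\<lambda>n i. y i (Suc n) - y i n"
  have "dz (Suc n) - dz n + wsq (\<lambda>i. ?a i - ?b i) = (\<Sum>i\<in>I. \<omega> i * (2 * ((?a i - ?b i) \<bullet> ?a i)))"
    unfolding two_inner_diff by (simp add: wsq_def dz_def distrib_left right_diff_distrib sum.distrib sum_subtractf)
  also have "\<dots> = (\<Sum>i\<in>I. \<omega> i * (2 * (?d (Suc (Suc n)) i \<bullet> (?a i - ?e)))) - 2 * (\<Sum>i\<in>I. \<omega> i * (?e \<bullet> (?b i - ?e)))"
    unfolding sum_distrib_left sum_subtractf[symmetric]
  proof (intro sum.cong refl)
    fix i assume i: "i \<in> I"
    have "?d (Suc (Suc n)) i = ?a i - ?b i + ?e" using z_step[OF i] by simp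
    moreover have "(a - b + e) \<bullet> (a - e) - e \<bullet> (b - e) = (a - b) \<bullet> a" for a b e :: 'a
      by (simp add: inner_simps inner_commute)
    ultimately show "\<omega> i * (2 * ((?a i - ?b i) \<bullet> ?a i)) = \<omega> i * (2 * (?d (Suc (Suc n)) i \<bullet> (?a i - ?e))) - 2 * (\<omega> i * (?e \<bullet> (?b i - ?e)))"
      by (simp only: mult.left_commute[of 2] right_diff_distrib[symmetric])
  qed
  also have "(\<Sum>i\<in>I. \<omega> i * (?e \<bullet> (?b i - ?e))) = 0"
    unfolding wsum_inner using sum_q[of n] by (simp add: q_def)
  finally have "dz (Suc n) - dz n + wsq (\<lambda>i. ?a i - ?b i) = (\<Sum>i\<in>I. \<omega> i * (2 * (?d (Suc (Suc n)) i \<bullet> (?a i - ?e))))" by simp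
  also have "\<dots> \<le> (\<Sum>i\<in>I. \<omega> i *
     (\<gamma> * L * (3 * (norm (?d (Suc (Suc n)) i))\<^sup>2 + 2 * (norm (?d (Suc n) i))\<^sup>2 + (norm (?d n i))\<^sup>2)
     + \<gamma> / \<beta> * ((norm (?d (Suc (Suc n)) i))\<^sup>2 + (norm (?d (Suc n) i))\<^sup>2)))"
    by (intro wsum_mono increment_estimate_pointwise)
  also have "\<dots> = \<gamma> * L * (3 * dy (Suc (Suc n)) + 2 * dy (Suc n) + dy n) + \<gamma> / \<beta> * (dy (Suc (Suc n)) + dy (Suc n))"
    unfolding dy_def wsq_def sum_distrib_left distrib_left right_diff_distrib sum.distrib sum_subtractf
    by (simp only: mult.left_commute mult.assoc)
  finally have 1: "dz (Suc n) - dz n + wsq (\<lambda>i. ?a i - ?b i) \<le> \<dots>" .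
  \<comment> \<open>Of the second difference of \<open>z\<close> only the part orthogonal to the
    diagonal is kept.\<close>
  have "(\<Sum>i\<in>I. \<omega> i *\<^sub>R (?a i - ?b i)) = (x (Suc (Suc (Suc n))) - x (Suc (Suc n))) - ?e"
    unfolding scaleR_diff_right[of _ "?a _"] sum_subtractf sum_dz ..
  from wsq_mean[OF this] have "wsq (\<lambda>i. q (Suc n) i - q n i) \<le> wsq (\<lambda>i. ?a i - ?b i)"
    by (simp add: q_def algebra_simps)
  with 1 show ?thesis by linarith
qed

text \<open>It decreases by \<open>fejer_estimate\<close> plus \<open>3/4\<close> times \<open>increment_estimate\<close>; the weight \<open>3/4\<close> makes the
  coefficient of \<open>wsq (q (Suc n) - q n)\<close> equal to \<open>3/4 + 1/4 = 1\<close>, as in \<open>dy_eq\<close>, where the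
  \<open>1/4\<close> comes from \<open>wsq_diff_le\<close>.\<close>

definition lyapunov :: "'a \<Rightarrow> ('i \<Rightarrow> 'a) \<Rightarrow> nat \<Rightarrow> real" where
  "lyapunov p \<zeta> n = wsq (\<lambda>i. z i (Suc n) - \<zeta> i) + 2 * \<gamma> * \<Phi> p n + 3/4 * dz n
     + (2 * (\<gamma> / \<beta>) + 21/2 * (\<gamma> * L)) / 2 * wsq (q n)
     + (33/4 * (\<gamma> * L) + 3/4 * (\<gamma> / \<beta>)) * dy (Suc n) + 7/4 * (\<gamma> * L) * dy n"

abbreviation slack :: real where "slack \<equiv> 1 - (2 * (\<gamma> / \<beta>) + 21/2 * (\<gamma> * L))"

text \<open>The splittings of \<open>dz (Suc n)\<close> and \<open>dy (Suc (Suc n))\<close> share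
  the same increment of \<open>x\<close>, so the two estimates can be compared in common
  variables.\<close>

lemma lyapunov_decrease:
  assumes p: "fixpoint p \<zeta>"
  shows "lyapunov p \<zeta> (Suc n) + slack * wsq (q (Suc n)) + 3/4 * slack * dy (Suc (Suc n)) \<le> lyapunov p \<zeta> n"
proof -
  have s: "0 \<le> 2 * (\<gamma> / \<beta>) + 21/2 * (\<gamma> * L)" "2 * (\<gamma> / \<beta>) + 21/2 * (\<gamma> * L) \<le> 1"
    using small \<gamma>_pos \<beta>_pos L_pos by simp_all
  show ?thesis
    using lyapunov_decrease_arith[OF fejer_estimate[OF p, of n, unfolded dz_eq[of "Suc n"] dy_eq]
        increment_estimate[of n, unfolded dz_eq[of "Suc n"] dy_eq] wsq_diff_le _ s]
    unfolding lyapunov_def dz_eq[of "Suc n"] dy_eq by simp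
qed

lemma y_minus_p:
  assumes p: "fixpoint p \<zeta>"
  shows "wsq (\<lambda>i. y i (Suc (Suc n)) - p) \<le> wsq (\<lambda>i. z i (Suc n) - \<zeta> i) + dz n"
proof -
  have "wsq (\<lambda>i. y i (Suc (Suc n)) - p) = wsq (\<lambda>i. q n i + (x (Suc (Suc n)) - p))"
    by (intro wsq_cong) (simp add: q_def z_step)
  also have "\<dots> = wsq (q n) + (norm (x (Suc (Suc n)) - p))\<^sup>2"
    by (rule wsq_add_mean_zero[OF sum_q])
  also have "wsq (q n) \<le> dz n" using dz_eq[of n] by simp
  also have "(norm (x (Suc (Suc n)) - p))\<^sup>2 \<le> wsq (\<lambda>i. z i (Suc n) - \<zeta> i)"
  proof -
    have "(\<Sum>i\<in>I. \<omega> i *\<^sub>R (z i (Suc n) - \<zeta> i)) = x (Suc (Suc n)) - p"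
      using p unfolding fixpoint_def by (simp add: scaleR_diff_right sum_subtractf x_step)
    from wsq_mean[OF this] wsq_nonneg show ?thesis by simp
  qed
  finally show ?thesis by simp
qed

text \<open>Cauchy-Schwarz and the Lipschitz bound, with the reflected point written through
  \<open>y - p\<close> and two increments; \<open>y_minus_p\<close> trades the distance of
  \<open>y\<close> for that of \<open>z\<close>.\<close>

lemma \<Phi>_lower_bound:
  assumes p: "fixpoint p \<zeta>"
  shows "- (2 * \<gamma> * \<Phi> p n) \<le> \<gamma> * L * (4 * dy (Suc n) + dy n + dz n + wsq (\<lambda>i. z i (Suc n) - \<zeta> i))"
proof -
  have "(\<Sum>i\<in>I. \<omega> i * (- 2 * ((y i (Suc (Suc n)) - y i (Suc n)) \<bullet> (B (r i n) - B p)))) \<le>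
    (\<Sum>i\<in>I. \<omega> i * (L * (4 * (norm (y i (Suc (Suc n)) - y i (Suc n)))\<^sup>2 + (norm (y i (Suc n) - y i n))\<^sup>2 + (norm (y i (Suc (Suc n)) - p))\<^sup>2)))"
  proof (intro wsum_mono)
    fix i
    define e d v where "e = y i (Suc (Suc n)) - y i (Suc n)" and "d = y i (Suc n) - y i n" and "v = y i (Suc (Suc n)) - p"
    have "- (e \<bullet> (B (r i n) - B p)) \<le> norm e * norm (B (r i n) - B p)"
      using norm_cauchy_schwarz[of "- e" "B (r i n) - B p"] by simp
    also have "\<dots> \<le> norm e * (L * norm (r i n - p))"
      by (intro mult_left_mono B_lip) simp
    also have "\<dots> \<le> norm e * (L * (norm v + norm e + norm d))"
    proof -
      have "r i n - p = (v - e) + d" by (simp add: e_def d_def v_def algebra_simps scaleR_2)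
      then have "norm (r i n - p) \<le> norm v + norm e + norm d"
        using norm_triangle_ineq[of "v - e" d] norm_triangle_ineq4[of v e] by simp
      then show ?thesis using L_pos by (intro mult_left_mono) auto
    qed
    finally have 1: "- (e \<bullet> (B (r i n) - B p)) \<le> L * (norm e * norm v + norm e * norm e + norm e * norm d)"
      by (simp add: algebra_simps)
    have "2 * (norm e * norm v + norm e * norm e + norm e * norm d) \<le> 4 * (norm e)\<^sup>2 + (norm d)\<^sup>2 + (norm v)\<^sup>2"
      using two_mult_le_squares[of "norm e" "norm v"] two_mult_le_squares[of "norm e" "norm d"]
      by (simp add: power2_eq_square)
    then have "L * (2 * (norm e * norm v + norm e * norm e + norm e * norm d)) \<le> L * (4 * (norm e)\<^sup>2 + (norm d)\<^sup>2 + (norm v)\<^sup>2)"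
      using L_pos by (intro mult_left_mono) auto
    with 1 show "- 2 * (e \<bullet> (B (r i n) - B p)) \<le> L * (4 * (norm e)\<^sup>2 + (norm d)\<^sup>2 + (norm v)\<^sup>2)"
      by argo
  qed
  also have "\<dots> = L * (4 * dy (Suc n) + dy n + wsq (\<lambda>i. y i (Suc (Suc n)) - p))"
    unfolding dy_def wsq_def sum_distrib_left distrib_left sum.distrib
    by (simp only: mult.left_commute mult.assoc)
  also have "\<dots> \<le> L * (4 * dy (Suc n) + dy n + (wsq (\<lambda>i. z i (Suc n) - \<zeta> i) + dz n))"
    using L_pos y_minus_p[OF p, of n] by (intro mult_left_mono add_left_mono) auto
  also have "(\<Sum>i\<in>I. \<omega> i * (- 2 * ((y i (Suc (Suc n)) - y i (Suc n)) \<bullet> (B (r i n) - B p)))) = - 2 * \<Phi> p n"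
    unfolding \<Phi>_def sum_distrib_left by (intro sum.cong refl mult.left_commute)
  finally have "\<gamma> * (- 2 * \<Phi> p n) \<le> \<gamma> * (L * (4 * dy (Suc n) + dy n + (wsq (\<lambda>i. z i (Suc n) - \<zeta> i) + dz n)))"
    using \<gamma>_pos by (intro mult_left_mono) auto
  then show ?thesis by (simp add: algebra_simps)
qed

lemma lyapunov_lower_bound:
  assumes p: "fixpoint p \<zeta>"
  shows "wsq (\<lambda>i. z i (Suc n) - \<zeta> i) / 2 \<le> lyapunov p \<zeta> n"
proof -
  have "0 \<le> \<gamma> * L" "0 \<le> \<gamma> / \<beta>" using \<gamma>_pos \<beta>_pos L_pos by auto
  moreover from this have "\<gamma> * L \<le> 1/2" using small by linarith
  ultimately show ?thesis
    unfolding lyapunov_def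
    by (intro lyapunov_lower_bound_arith[OF \<Phi>_lower_bound[OF p]]) (auto simp: dy_def dz_def wsq_nonneg)
qed

section \<open>Vanishing increments and convergence of the distances to fixed points\<close>

lemma wsq_component:
  assumes "(\<lambda>n. wsq (u n)) \<longlonglongrightarrow> 0" "i \<in> I"
  shows "(\<lambda>n. u n i) \<longlonglongrightarrow> 0"
proof -
  have le: "(norm (u n i))\<^sup>2 \<le> wsq (u n) / \<omega> i" for n
  proof -
    have "\<omega> i * (norm (u n i))\<^sup>2 \<le> wsq (u n)"
      unfolding wsq_def using \<omega>_pos assms(2) finite_I
      by (intro member_le_sum) (auto simp: less_imp_le)
    then show ?thesis using \<omega>_pos[OF assms(2)] by (simp add: field_simps)
  qed
  have "(\<lambda>n. wsq (u n) / \<omega> i) \<longlonglongrightarrow> 0 / \<omega> i"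
    using \<omega>_pos[OF assms(2)] assms(1) by (intro tendsto_intros) auto
  then have "(\<lambda>n. (norm (u n i))\<^sup>2) \<longlonglongrightarrow> 0"
    by (intro tendsto_sandwich[of "\<lambda>_. 0" "\<lambda>n. (norm (u n i))\<^sup>2" _ "\<lambda>n. wsq (u n) / \<omega> i"]
        always_eventually allI le tendsto_const) auto
  from tendsto_real_sqrt[OF this] show ?thesis by (simp add: tendsto_norm_zero_iff)
qed

lemma Bseq_component:
  assumes "\<And>n. wsq (\<lambda>i. u i n - v i) \<le> M" "i \<in> I"
  shows "Bseq (u i)"
proof (rule BseqI')
  fix n
  have "\<omega> i * (norm (u i n - v i))\<^sup>2 \<le> wsq (\<lambda>i. u i n - v i)"
    unfolding wsq_def using \<omega>_pos assms(2) finite_I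
    by (intro member_le_sum[of i I "\<lambda>i. \<omega> i * (norm (u i n - v i))\<^sup>2"]) (auto simp: less_imp_le)
  with assms(1)[of n] have "(norm (u i n - v i))\<^sup>2 \<le> M / \<omega> i"
    using \<omega>_pos[OF assms(2)] by (simp add: field_simps)
  then have "norm (u i n - v i) \<le> sqrt (M / \<omega> i)" by (rule real_le_rsqrt)
  then show "norm (u i n) \<le> sqrt (M / \<omega> i) + norm (v i)"
    using norm_triangle_sub[of "u i n" "v i"] by simp
qed

lemma slack_pos: "0 < slack" using small by simp

context
  fixes p \<zeta> assumes p: "fixpoint p \<zeta>"
begin

lemma lyapunov_convergent: "convergent (lyapunov p \<zeta>)"
proof -
  have "decseq (lyapunov p \<zeta>)"
  proof (rule decseq_SucI)
    fix n
    have "0 \<le> slack * wsq (q (Suc n))" "0 \<le> 3/4 * slack * dy (Suc (Suc n))"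
      using slack_pos by (auto simp: dy_def wsq_nonneg intro!: mult_nonneg_nonneg)
    with lyapunov_decrease[OF p, of n] show "lyapunov p \<zeta> (Suc n) \<le> lyapunov p \<zeta> n" by linarith
  qed
  moreover have "0 \<le> lyapunov p \<zeta> n" for n
    using lyapunov_lower_bound[OF p, of n] wsq_nonneg[of "\<lambda>i. z i (Suc n) - \<zeta> i"] by linarith
  ultimately show ?thesis
    using decseq_convergent[of "lyapunov p \<zeta>" 0] unfolding convergent_def by blast
qed

lemma lyapunov_drop: "(\<lambda>n. lyapunov p \<zeta> n - lyapunov p \<zeta> (Suc n)) \<longlonglongrightarrow> 0"
proof -
  obtain l where "lyapunov p \<zeta> \<longlonglongrightarrow> l" using lyapunov_convergent unfolding convergent_def by blast
  from tendsto_diff[OF this LIMSEQ_Suc[OF this]] show ?thesis by simp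
qed

lemma dy_tendsto: "dy \<longlonglongrightarrow> 0"
proof -
  have "(\<lambda>n. dy (Suc (Suc n))) \<longlonglongrightarrow> 0"
  proof (rule tendsto_zero_of_mult_le[OF lyapunov_drop, of "3/4 * slack"])
    fix n
    have "0 \<le> slack * wsq (q (Suc n))"
      using slack_pos by (auto simp: wsq_nonneg intro!: mult_nonneg_nonneg)
    with lyapunov_decrease[OF p, of n]
    show "3/4 * slack * dy (Suc (Suc n)) \<le> lyapunov p \<zeta> n - lyapunov p \<zeta> (Suc n)" by linarith
  qed (use slack_pos in \<open>simp_all add: dy_def wsq_nonneg\<close>)
  then show ?thesis by (rule LIMSEQ_imp_Suc[OF LIMSEQ_imp_Suc])
qed

lemma q_tendsto: "(\<lambda>n. wsq (q n)) \<longlonglongrightarrow> 0"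
proof -
  have "(\<lambda>n. wsq (q (Suc n))) \<longlonglongrightarrow> 0"
  proof (rule tendsto_zero_of_mult_le[OF lyapunov_drop slack_pos])
    fix n
    have "0 \<le> 3/4 * slack * dy (Suc (Suc n))"
      using slack_pos by (auto simp: dy_def wsq_nonneg intro!: mult_nonneg_nonneg)
    with lyapunov_decrease[OF p, of n]
    show "slack * wsq (q (Suc n)) \<le> lyapunov p \<zeta> n - lyapunov p \<zeta> (Suc n)" by linarith
  qed (rule wsq_nonneg)
  then show ?thesis by (rule LIMSEQ_imp_Suc)
qed

text \<open>The diagonal part of the increment of \<open>z\<close> is controlled by
  \<open>dy\<close>, the orthogonal part by \<open>q_tendsto\<close>.\<close>

lemma dz_tendsto: "dz \<longlonglongrightarrow> 0"
proof -
  have "(\<lambda>n. (norm (x (Suc (Suc (Suc n))) - x (Suc (Suc n))))\<^sup>2) \<longlonglongrightarrow> 0"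
    by (rule tendsto_zero_of_mult_le[OF LIMSEQ_Suc[OF LIMSEQ_Suc[OF dy_tendsto]], of 1])
      (simp_all add: dy_eq wsq_nonneg)
  from tendsto_add[OF LIMSEQ_Suc[OF q_tendsto] this]
  have "(\<lambda>n. dz (Suc n)) \<longlonglongrightarrow> 0" unfolding dz_eq by simp
  then show ?thesis by (rule LIMSEQ_imp_Suc)
qed

lemma y_diff_tendsto: "i \<in> I \<Longrightarrow> (\<lambda>n. y i (Suc n) - y i n) \<longlonglongrightarrow> 0"
  by (rule wsq_component[OF dy_tendsto[unfolded dy_def]])

lemma z_diff_tendsto: "i \<in> I \<Longrightarrow> (\<lambda>n. z i (Suc n) - z i n) \<longlonglongrightarrow> 0"
  by (rule wsq_component[OF dz_tendsto[unfolded dz_def]])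

lemma wsq_z_bounded: "\<exists>M. \<forall>n. wsq (\<lambda>i. z i (Suc n) - \<zeta> i) \<le> M"
proof -
  obtain M where M: "\<And>n. norm (lyapunov p \<zeta> n) \<le> M"
    using convergent_imp_Bseq[OF lyapunov_convergent] unfolding Bseq_def by blast
  have "wsq (\<lambda>i. z i (Suc n) - \<zeta> i) \<le> 2 * M" for n
    using lyapunov_lower_bound[OF p, of n] M[of n] by simp
  then show ?thesis by blast
qed

lemma z_Bseq: "i \<in> I \<Longrightarrow> Bseq (z i)"
proof -
  assume i: "i \<in> I"
  obtain M where "\<And>n. wsq (\<lambda>i. z i (Suc n) - \<zeta> i) \<le> M" using wsq_z_bounded by blast
  from Bseq_component[of "\<lambda>i n. z i (Suc n)", OF this i] show ?thesis by (simp add: Bseq_Suc_iff[of "z i"] Bseq_Suc_iff[of "y i"] Bseq_Suc_iff[of "\<lambda>n. y i (Suc n)"])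
qed

lemma y_Bseq: "i \<in> I \<Longrightarrow> Bseq (y i)"
proof -
  assume i: "i \<in> I"
  obtain M where M: "\<And>n. wsq (\<lambda>i. z i (Suc n) - \<zeta> i) \<le> M" using wsq_z_bounded by blast
  obtain M' where M': "\<And>n. norm (dz n) \<le> M'"
    using convergent_imp_Bseq[OF convergentI[OF dz_tendsto]] unfolding Bseq_def by blast
  have "wsq (\<lambda>i. y i (Suc (Suc n)) - p) \<le> M + M'" for n
    using y_minus_p[OF p, of n] M[of n] M'[of n] by simp
  from Bseq_component[of "\<lambda>i n. y i (Suc (Suc n))", OF this i] show ?thesis by (simp add: Bseq_Suc_iff[of "z i"] Bseq_Suc_iff[of "y i"] Bseq_Suc_iff[of "\<lambda>n. y i (Suc n)"])
qed

lemma B_Bseq: "Bseq u \<Longrightarrow> Bseq (\<lambda>n. B (u n) - B v)"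
proof -
  assume "Bseq u"
  then obtain K where K: "\<And>n. norm (u n) \<le> K" unfolding Bseq_def by blast
  show ?thesis
  proof (rule BseqI')
    fix n
    have "norm (u n - v) \<le> K + norm v" using norm_triangle_ineq4[of "u n" v] K[of n] by simp
    then have "L * norm (u n - v) \<le> L * (K + norm v)" using L_pos by simp
    with B_lip[of "u n" v] show "norm (B (u n) - B v) \<le> L * (K + norm v)" by simp
  qed
qed

lemma \<Phi>_tendsto: "\<Phi> p \<longlonglongrightarrow> 0"
proof -
  have "(\<lambda>n. \<Sum>i\<in>I. \<omega> i * ((y i (Suc (Suc n)) - y i (Suc n)) \<bullet> (B (r i n) - B p))) \<longlonglongrightarrow> (\<Sum>i\<in>I. \<omega> i * 0)"
  proof (intro tendsto_sum tendsto_mult_left inner_tendsto_zero)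
    fix i assume i: "i \<in> I"
    show "(\<lambda>n. y i (Suc (Suc n)) - y i (Suc n)) \<longlonglongrightarrow> 0"
      by (rule LIMSEQ_Suc[OF y_diff_tendsto[OF i]])
    obtain K where K: "\<And>n. norm (y i n) \<le> K" using y_Bseq[OF i] unfolding Bseq_def by blast
    have "norm (r i n) \<le> 3 * K" for n
      using norm_triangle_ineq4[of "2 *\<^sub>R y i (Suc n)" "y i n"] K[of "Suc n"] K[of n] by simp
    then show "Bseq (\<lambda>n. B (r i n) - B p)" by (intro B_Bseq BseqI')
  qed
  then show ?thesis by (simp add: \<Phi>_def[abs_def])
qed

text \<open>All other terms of the convergent Lyapunov function vanish in the limit. This is the
  hypothesis of Opial's argument.\<close>

lemma wsq_z_convergent: "convergent (\<lambda>n. wsq (\<lambda>i. z i n - \<zeta> i))"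
proof -
  obtain l where l: "lyapunov p \<zeta> \<longlonglongrightarrow> l" using lyapunov_convergent unfolding convergent_def by blast
  have "(\<lambda>n. lyapunov p \<zeta> n - 2 * \<gamma> * \<Phi> p n - 3/4 * dz n
     - (2 * (\<gamma> / \<beta>) + 21/2 * (\<gamma> * L)) / 2 * wsq (q n)
     - (33/4 * (\<gamma> * L) + 3/4 * (\<gamma> / \<beta>)) * dy (Suc n) - 7/4 * (\<gamma> * L) * dy n) \<longlonglongrightarrow>
     l - 2 * \<gamma> * 0 - 3/4 * 0 - (2 * (\<gamma> / \<beta>) + 21/2 * (\<gamma> * L)) / 2 * 0
     - (33/4 * (\<gamma> * L) + 3/4 * (\<gamma> / \<beta>)) * 0 - 7/4 * (\<gamma> * L) * 0"
    by (intro tendsto_diff tendsto_mult_left l \<Phi>_tendsto dz_tendsto q_tendsto dy_tendsto LIMSEQ_Suc[OF dy_tendsto])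
  then have "(\<lambda>n. wsq (\<lambda>i. z i (Suc n) - \<zeta> i)) \<longlonglongrightarrow> l"
    unfolding lyapunov_def by simp
  then show ?thesis unfolding convergent_def by (intro exI) (rule LIMSEQ_imp_Suc)
qed

end

subsection \<open>Weak convergence\<close>

lemma wsq_eq_0D:
  assumes "wsq u = 0" "i \<in> I"
  shows "u i = 0"
proof -
  have "\<forall>i\<in>I. \<omega> i * (norm (u i))\<^sup>2 = 0"
    using assms(1) \<omega>_pos finite_I unfolding wsq_def
    by (subst (asm) sum_nonneg_eq_0_iff) (auto simp: less_imp_le)
  then show ?thesis using assms(2) \<omega>_pos[OF assms(2)] by auto
qed

text \<open>Plays the role of a weak cluster point of the tuples with index in \<open>S\<close>,
  without extracting a subsequence; \<open>g\<close> and \<open>c\<close> describe a closed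
  half-space of the product space.\<close>

definition cluster :: "nat set \<Rightarrow> ('i \<Rightarrow> 'a) \<Rightarrow> bool" where
  "cluster S \<zeta> \<longleftrightarrow> (\<forall>g c. eventually (\<lambda>k. k \<in> S \<longrightarrow> c \<le> (\<Sum>i\<in>I. z i k \<bullet> g i)) sequentially \<longrightarrow>
            c \<le> (\<Sum>i\<in>I. \<zeta> i \<bullet> g i))"

lemma cluster_exists:
  assumes p: "fixpoint p \<zeta>" and S: "infinite S"
  shows "\<exists>\<zeta>'. cluster S \<zeta>'"
proof -
  have "\<exists>K. \<forall>k. norm (z i k) \<le> K" if "i \<in> I" for i
    using z_Bseq[OF p that] unfolding Bseq_def by blast
  then obtain K where K: "\<And>i k. i \<in> I \<Longrightarrow> norm (z i k) \<le> K i" by metis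
  have "(\<Sum>i\<in>I. (norm (z i k))\<^sup>2) \<le> (\<Sum>i\<in>I. (K i)\<^sup>2)" for k
    by (intro sum_mono power_mono K) auto
  from weak_cluster_tuple[OF finite_I this S] show ?thesis unfolding cluster_def .
qed

lemma cluster_lower:
  assumes "cluster S \<zeta>" and ev: "\<And>e. 0 < e \<Longrightarrow> \<forall>\<^sub>F k in sequentially. c - e \<le> (\<Sum>i\<in>I. z i k \<bullet> g i)"
  shows "c \<le> (\<Sum>i\<in>I. \<zeta> i \<bullet> g i)"
proof (rule field_le_epsilon)
  fix e :: real assume "0 < e"
  then have "\<forall>\<^sub>F k in sequentially. k \<in> S \<longrightarrow> c - e \<le> (\<Sum>i\<in>I. z i k \<bullet> g i)"
    using ev[of e] by (auto elim: eventually_mono)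
  then have "c - e \<le> (\<Sum>i\<in>I. \<zeta> i \<bullet> g i)" using assms(1) unfolding cluster_def by blast
  then show "c \<le> (\<Sum>i\<in>I. \<zeta> i \<bullet> g i) + e" by simp
qed

text \<open>Half-spaces in the directions \<open>g\<close> and \<open>- g\<close> enclose the value:
  clusters see the limit of every functional that converges along the whole sequence.\<close>

lemma cluster_tendsto:
  assumes cl: "cluster S \<zeta>" and lim: "(\<lambda>k. \<Sum>i\<in>I. z i k \<bullet> g i) \<longlonglongrightarrow> l"
  shows "(\<Sum>i\<in>I. \<zeta> i \<bullet> g i) = l"
proof (rule antisym)
  have "- l \<le> (\<Sum>i\<in>I. \<zeta> i \<bullet> (- g i))"
  proof (rule cluster_lower[OF cl])
    fix e :: real assume "0 < e"
    with order_tendstoD(2)[OF lim, of "l + e"]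
    have "\<forall>\<^sub>F k in sequentially. (\<Sum>i\<in>I. z i k \<bullet> g i) < l + e" by simp
    then show "\<forall>\<^sub>F k in sequentially. - l - e \<le> (\<Sum>i\<in>I. z i k \<bullet> (- g i))"
      by eventually_elim (simp add: sum_negf)
  qed
  then show "(\<Sum>i\<in>I. \<zeta> i \<bullet> g i) \<le> l" by (simp add: sum_negf)
  show "l \<le> (\<Sum>i\<in>I. \<zeta> i \<bullet> g i)"
  proof (rule cluster_lower[OF cl])
    fix e :: real assume "0 < e"
    with order_tendstoD(1)[OF lim, of "l - e"]
    have "\<forall>\<^sub>F k in sequentially. l - e < (\<Sum>i\<in>I. z i k \<bullet> g i)" by simp
    then show "\<forall>\<^sub>F k in sequentially. l - e \<le> (\<Sum>i\<in>I. z i k \<bullet> g i)"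
      by eventually_elim simp
  qed
qed

text \<open>The terms quadratic in \<open>u\<close> cancel, so this expression is affine and can be tested on
  cluster tuples.\<close>

lemma residual_affine:
  assumes "(\<Sum>i\<in>I. \<omega> i *\<^sub>R u i) = v"
  shows "(\<Sum>i\<in>I. \<omega> i * ((v - s i) \<bullet> ((1 / \<gamma>) *\<^sub>R (v - u i) - g i))) =
    (\<Sum>i\<in>I. u i \<bullet> (\<omega> i *\<^sub>R ((1 / \<gamma>) *\<^sub>R (s i - (\<Sum>j\<in>I. \<omega> j *\<^sub>R s j)) - (\<Sum>j\<in>I. \<omega> j *\<^sub>R g j))))
    + (\<Sum>i\<in>I. \<omega> i * (s i \<bullet> g i))"
proof -
  define \<sigma> where "\<sigma> = (\<Sum>j\<in>I. \<omega> j *\<^sub>R s j)"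
  define h where "h = (\<Sum>j\<in>I. \<omega> j *\<^sub>R g j)"
  have "(\<Sum>i\<in>I. \<omega> i * ((v - s i) \<bullet> ((1 / \<gamma>) *\<^sub>R (v - u i) - g i))) =
     (1 / \<gamma>) * ((\<Sum>i\<in>I. \<omega> i * (v \<bullet> v)) - (\<Sum>i\<in>I. \<omega> i * (v \<bullet> u i)) - (\<Sum>i\<in>I. \<omega> i * (v \<bullet> s i))
       + (\<Sum>i\<in>I. \<omega> i * (u i \<bullet> s i))) - (\<Sum>i\<in>I. \<omega> i * (v \<bullet> g i)) + (\<Sum>i\<in>I. \<omega> i * (s i \<bullet> g i))"
    unfolding sum_distrib_left sum_subtractf[symmetric] sum.distrib[symmetric]
  proof (intro sum.cong refl)
    fix i
    have "\<omega> i * ((v - s i) \<bullet> ((1 / \<gamma>) *\<^sub>R (v - u i) - g i)) =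
      \<omega> i * ((1 / \<gamma>) * (v \<bullet> v - v \<bullet> u i - v \<bullet> s i + u i \<bullet> s i) - v \<bullet> g i + s i \<bullet> g i)"
      by (simp only: inner_diff_left inner_diff_right inner_scaleR_right inner_commute[of "s i" v] inner_commute[of "s i" "u i"])
         (simp add: algebra_simps)
    then show "\<omega> i * ((v - s i) \<bullet> ((1 / \<gamma>) *\<^sub>R (v - u i) - g i)) =
      1 / \<gamma> * (\<omega> i * (v \<bullet> v) - \<omega> i * (v \<bullet> u i) - \<omega> i * (v \<bullet> s i) + \<omega> i * (u i \<bullet> s i)) - \<omega> i * (v \<bullet> g i) + \<omega> i * (s i \<bullet> g i)"
      by (simp only: right_diff_distrib distrib_left mult.left_commute[of "\<omega> i" "1 / \<gamma>"])
  qed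
  also have "\<dots> = (1 / \<gamma>) * ((\<Sum>i\<in>I. \<omega> i * (u i \<bullet> s i)) - v \<bullet> \<sigma>) - v \<bullet> h + (\<Sum>i\<in>I. \<omega> i * (s i \<bullet> g i))"
    unfolding wsum_const unfolding wsum_inner assms \<sigma>_def h_def by simp
  also have "(1 / \<gamma>) * ((\<Sum>i\<in>I. \<omega> i * (u i \<bullet> s i)) - v \<bullet> \<sigma>) - v \<bullet> h =
     (\<Sum>i\<in>I. u i \<bullet> (\<omega> i *\<^sub>R ((1 / \<gamma>) *\<^sub>R (s i - \<sigma>) - h)))"
  proof -
    have "v \<bullet> w = (\<Sum>i\<in>I. \<omega> i * (u i \<bullet> w))" for w
      unfolding assms[symmetric] by (simp add: inner_sum_left)
    then show ?thesis
      by (simp only: sum_distrib_left sum_subtractf[symmetric])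
        (intro sum.cong refl, simp add: inner_simps algebra_simps)
  qed
  finally show ?thesis unfolding \<sigma>_def h_def .
qed

text \<open>Monotonicity of \<open>A i\<close> against the graph point \<open>(s i, t i)\<close>,
  with \<open>B\<close> and \<open>C\<close> moved to \<open>s i\<close> by their own monotonicity.
  Replacing all iterates by \<open>x (Suc n)\<close> and \<open>z i n\<close> costs products of
  vanishing and bounded sequences.\<close>

lemma residual_eventually_nonneg:
  assumes p: "fixpoint p \<zeta>" and t: "\<And>i. i \<in> I \<Longrightarrow> t i \<in> A i (s i)" and e: "0 < e"
  shows "\<forall>\<^sub>F n in sequentially. - e \<le> (\<Sum>i\<in>I. \<omega> i * ((x (Suc n) - s i) \<bullet>
    ((1 / \<gamma>) *\<^sub>R (x (Suc n) - z i n) - ((1 / \<omega> i) *\<^sub>R t i + B (s i) + C (s i)))))"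
proof -
  define g where "g i = (1 / \<omega> i) *\<^sub>R t i + B (s i) + C (s i)" for i
  \<comment> \<open>The error of shifting the arguments of \<open>B\<close> and \<open>C\<close> to
    the newest \<open>y\<close> and of replacing the new \<open>z\<close> by the old;
    \<open>\<rho>\<close> adds the error of replacing \<open>y\<close> by \<open>x\<close>.\<close>
  define \<epsilon> where "\<epsilon> n i = (B (y i (Suc (Suc n))) - B (r i n)) + (C (y i (Suc (Suc n))) - C (y i (Suc n)))
     - (1 / \<gamma>) *\<^sub>R (z i (Suc n) - z i n)" for n i
  define \<rho> where "\<rho> n i = \<epsilon> n i \<bullet> (y i (Suc (Suc n)) - s i) +
     (z i (Suc n) - z i n) \<bullet> ((1 / \<gamma>) *\<^sub>R (x (Suc n) - z i n) - g i)" for n i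
  have pw: "0 \<le> (x (Suc n) - s i) \<bullet> ((1 / \<gamma>) *\<^sub>R (x (Suc n) - z i n) - g i) + \<rho> n i" if i: "i \<in> I" for n i
  proof -
    let ?y2 = "y i (Suc (Suc n))" and ?y1 = "y i (Suc n)" and ?z1 = "z i (Suc n)" and ?z0 = "z i n" and ?x = "x (Suc n)"
    have "0 \<le> (?y2 - s i) \<bullet> ((\<omega> i / \<gamma>) *\<^sub>R (?x - ?z1 - \<gamma> *\<^sub>R B (r i n) - \<gamma> *\<^sub>R C ?y1) - t i)"
      by (rule maximally_monotone_monotone[OF A[OF i] y_step[OF i] t[OF i]])
    then have "0 \<le> (1 / \<omega> i) * ((?y2 - s i) \<bullet> ((\<omega> i / \<gamma>) *\<^sub>R (?x - ?z1 - \<gamma> *\<^sub>R B (r i n) - \<gamma> *\<^sub>R C ?y1) - t i))"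
      using \<omega>_pos[OF i] by simp
    also have "\<dots> = (?y2 - s i) \<bullet> ((1 / \<gamma>) *\<^sub>R (?x - ?z1) - B (r i n) - C ?y1 - (1 / \<omega> i) *\<^sub>R t i)"
      unfolding inner_scaleR_right[symmetric] using \<omega>_pos[OF i] \<gamma>_pos
      by (simp add: scaleR_diff_right)
    also have "\<dots> \<le> (?y2 - s i) \<bullet> ((1 / \<gamma>) *\<^sub>R (?x - ?z1) - B (r i n) - C ?y1 - (1 / \<omega> i) *\<^sub>R t i)
        + (?y2 - s i) \<bullet> (B ?y2 - B (s i)) + (?y2 - s i) \<bullet> (C ?y2 - C (s i))"
    proof -
      have "0 \<le> (?y2 - s i) \<bullet> (B ?y2 - B (s i))" using B_mono unfolding monotone_fun_def by blast
      moreover have "0 \<le> \<beta> * (norm (C ?y2 - C (s i)))\<^sup>2" using \<beta>_pos by simp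
      then have "0 \<le> (?y2 - s i) \<bullet> (C ?y2 - C (s i))" using C_coco unfolding cocoercive_def
        by (meson order_trans)
      ultimately show ?thesis by simp
    qed
    also have "\<dots> = (?y2 - s i) \<bullet> ((1 / \<gamma>) *\<^sub>R (?x - ?z0) - g i + \<epsilon> n i)"
      unfolding inner_add_right[symmetric] g_def \<epsilon>_def
      by (simp add: algebra_simps)
    also have "\<dots> = (?y2 - s i) \<bullet> ((1 / \<gamma>) *\<^sub>R (?x - ?z0) - g i) + \<epsilon> n i \<bullet> (?y2 - s i)"
      by (simp add: inner_add_right inner_commute)
    also have "?y2 - s i = (?x - s i) + (?z1 - ?z0)" using z_step[OF i, of n] by simp
    finally show ?thesis unfolding \<rho>_def inner_add_left
      using z_step[OF i, of n] by simp
  qed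
  have "(\<lambda>n. \<Sum>i\<in>I. \<omega> i * \<rho> n i) \<longlonglongrightarrow> (\<Sum>i\<in>I. \<omega> i * (0 + 0))"
    unfolding \<rho>_def
  proof (intro tendsto_sum tendsto_mult_left tendsto_add inner_tendsto_zero)
    fix i assume i: "i \<in> I"
    note yd = y_diff_tendsto[OF p i] and zd = z_diff_tendsto[OF p i]
    have "(\<lambda>n. B (y i (Suc (Suc n))) - B (r i n)) \<longlonglongrightarrow> 0"
    proof (rule Lim_null_comparison)
      show "\<forall>\<^sub>F n in sequentially. norm (B (y i (Suc (Suc n))) - B (r i n)) \<le>
         L * norm ((y i (Suc (Suc n)) - y i (Suc n)) - (y i (Suc n) - y i n))"
      proof (intro always_eventually allI)
        fix n
        have "y i (Suc (Suc n)) - r i n = (y i (Suc (Suc n)) - y i (Suc n)) - (y i (Suc n) - y i n)"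
          by (simp add: scaleR_2)
        with B_lip[of "y i (Suc (Suc n))" "r i n"]
        show "norm (B (y i (Suc (Suc n))) - B (r i n)) \<le>
           L * norm ((y i (Suc (Suc n)) - y i (Suc n)) - (y i (Suc n) - y i n))" by simp
      qed
      have "(\<lambda>n. L * norm ((y i (Suc (Suc n)) - y i (Suc n)) - (y i (Suc n) - y i n))) \<longlonglongrightarrow> L * norm (0 - 0 :: 'a)"
        by (intro tendsto_intros LIMSEQ_Suc[OF yd] yd)
      then show "(\<lambda>n. L * norm ((y i (Suc (Suc n)) - y i (Suc n)) - (y i (Suc n) - y i n))) \<longlonglongrightarrow> 0" by simp
    qed
    moreover have "(\<lambda>n. C (y i (Suc (Suc n))) - C (y i (Suc n))) \<longlonglongrightarrow> 0"
    proof (rule Lim_null_comparison)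
      show "\<forall>\<^sub>F n in sequentially. norm (C (y i (Suc (Suc n))) - C (y i (Suc n))) \<le> norm (y i (Suc (Suc n)) - y i (Suc n)) / \<beta>"
        by (intro always_eventually allI cocoercive_lipschitz[OF C_coco \<beta>_pos])
      have "(\<lambda>n. norm (y i (Suc (Suc n)) - y i (Suc n)) / \<beta>) \<longlonglongrightarrow> norm (0 :: 'a) / \<beta>"
        using \<beta>_pos by (intro tendsto_intros LIMSEQ_Suc[OF yd]) auto
      then show "(\<lambda>n. norm (y i (Suc (Suc n)) - y i (Suc n)) / \<beta>) \<longlonglongrightarrow> 0" by simp
    qed
    ultimately have "(\<lambda>n. \<epsilon> n i) \<longlonglongrightarrow> 0 + 0 - (1 / \<gamma>) *\<^sub>R 0"
      unfolding \<epsilon>_def by (intro tendsto_add tendsto_diff tendsto_scaleR tendsto_const zd)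
    then show "(\<lambda>n. \<epsilon> n i) \<longlonglongrightarrow> 0" by simp
    show "(\<lambda>n. z i (Suc n) - z i n) \<longlonglongrightarrow> 0" by (rule zd)
    obtain K where K: "\<And>n. norm (y i n) \<le> K" using y_Bseq[OF p i] unfolding Bseq_def by blast
    obtain M where M: "\<And>n. norm (z i n) \<le> M" using z_Bseq[OF p i] unfolding Bseq_def by blast
    show "Bseq (\<lambda>n. y i (Suc (Suc n)) - s i)"
    proof (rule BseqI')
      show "norm (y i (Suc (Suc n)) - s i) \<le> K + norm (s i)" for n
        using norm_triangle_ineq4[of "y i (Suc (Suc n))" "s i"] K[of "Suc (Suc n)"] by simp
    qed
    show "Bseq (\<lambda>n. (1 / \<gamma>) *\<^sub>R (x (Suc n) - z i n) - g i)"
    proof (rule BseqI')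
      fix n
      have eq: "x (Suc n) - z i n = y i (Suc (Suc n)) - z i (Suc n)" using z_step[OF i, of n] by simp
      have "norm (x (Suc n) - z i n) \<le> K + M"
        unfolding eq using norm_triangle_ineq4[of "y i (Suc (Suc n))" "z i (Suc n)"] K[of "Suc (Suc n)"] M[of "Suc n"] by simp
      then have "norm ((1 / \<gamma>) *\<^sub>R (x (Suc n) - z i n)) \<le> (1 / \<gamma>) * (K + M)"
        using \<gamma>_pos by (simp add: divide_right_mono)
      then show "norm ((1 / \<gamma>) *\<^sub>R (x (Suc n) - z i n) - g i) \<le> (1 / \<gamma>) * (K + M) + norm (g i)"
        using norm_triangle_ineq4[of "(1 / \<gamma>) *\<^sub>R (x (Suc n) - z i n)" "g i"] by linarith
    qed
  qed
  then have "(\<lambda>n. \<Sum>i\<in>I. \<omega> i * \<rho> n i) \<longlonglongrightarrow> 0" by simp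
  from order_tendstoD(2)[OF this e] have "\<forall>\<^sub>F n in sequentially. (\<Sum>i\<in>I. \<omega> i * \<rho> n i) < e" .
  then show ?thesis
    unfolding g_def[symmetric]
  proof eventually_elim
    case (elim n)
    have "(\<Sum>i\<in>I. \<omega> i * 0) \<le> (\<Sum>i\<in>I. \<omega> i * ((x (Suc n) - s i) \<bullet> ((1 / \<gamma>) *\<^sub>R (x (Suc n) - z i n) - g i) + \<rho> n i))"
      by (rule wsum_mono[OF pw])
    with elim show ?case by (simp add: distrib_left sum.distrib)
  qed
qed

text \<open>Being affine in \<open>z\<close>, the asymptotic inequality passes to the cluster and
  holds for all test points of the graphs. Test points solving a perturbed resolvent equation turn
  it into minus a multiple of the squared distance from \<open>s\<close> to \<open>p\<close>, so
  \<open>s i = p\<close>.\<close>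

lemma cluster_fixpoint:
  assumes p: "fixpoint p0 \<zeta>0" and cl: "cluster S \<zeta>"
  shows "fixpoint (\<Sum>i\<in>I. \<omega> i *\<^sub>R \<zeta> i) \<zeta>"
proof -
  define p where "p = (\<Sum>i\<in>I. \<omega> i *\<^sub>R \<zeta> i)"
  have test: "0 \<le> (\<Sum>i\<in>I. \<omega> i * ((p - s i) \<bullet> ((1 / \<gamma>) *\<^sub>R (p - \<zeta> i) - ((1 / \<omega> i) *\<^sub>R t i + B (s i) + C (s i)))))"
    if t: "\<And>i. i \<in> I \<Longrightarrow> t i \<in> A i (s i)" for s t
  proof -
    define g where "g i = (1 / \<omega> i) *\<^sub>R t i + B (s i) + C (s i)" for i
    define G where "G i = \<omega> i *\<^sub>R ((1 / \<gamma>) *\<^sub>R (s i - (\<Sum>j\<in>I. \<omega> j *\<^sub>R s j)) - (\<Sum>j\<in>I. \<omega> j *\<^sub>R g j))" for i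
    define c where "c = (\<Sum>i\<in>I. \<omega> i * (s i \<bullet> g i))"
    note aff = residual_affine[of _ _ s g, folded G_def c_def]
    have "- c \<le> (\<Sum>i\<in>I. \<zeta> i \<bullet> G i)"
    proof (rule cluster_lower[OF cl])
      fix e :: real assume e: "0 < e"
      have "\<forall>\<^sub>F n in sequentially. - e \<le> (\<Sum>i\<in>I. z i n \<bullet> G i) + c"
        using residual_eventually_nonneg[OF p t e, folded g_def]
        unfolding aff[OF x_step[symmetric]] .
      then show "\<forall>\<^sub>F n in sequentially. - c - e \<le> (\<Sum>i\<in>I. z i n \<bullet> G i)"
        by eventually_elim simp
    qed
    then show ?thesis unfolding g_def[symmetric] aff[OF p_def[symmetric]] by simp
  qed
  define K where "K = L + 1 / \<beta>"
  have K: "0 < K" using L_pos \<beta>_pos by (simp add: K_def add_pos_pos)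
  \<comment> \<open>\<open>K\<close> is a Lipschitz constant of \<open>B + C\<close>, so the
    contraction constant below is \<open>1/2\<close>.\<close>
  define \<mu> where "\<mu> = 1 / (2 * K)"
  have \<mu>: "0 < \<mu>" "\<mu> * K < 1" using K by (auto simp: \<mu>_def)
  have "\<exists>s. \<exists>t\<in>A i s. s + \<mu> *\<^sub>R ((1 / \<omega> i) *\<^sub>R t + B s + C s) = p + \<mu> *\<^sub>R ((1 / \<gamma>) *\<^sub>R (p - \<zeta> i))"
    if i: "i \<in> I" for i
  proof -
    have w: "0 < \<omega> i" by (rule \<omega>_pos[OF i])
    have lip: "norm (\<omega> i *\<^sub>R (B u + C u) - \<omega> i *\<^sub>R (B v + C v)) \<le> \<omega> i * K * norm (u - v)" for u v
    proof -
      have "norm ((B u - B v) + (C u - C v)) \<le> K * norm (u - v)"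
        using norm_triangle_ineq[of "B u - B v" "C u - C v"] B_lip[of u v] cocoercive_lipschitz[OF C_coco \<beta>_pos, of u v]
        by (simp add: K_def algebra_simps)
      then have "norm (\<omega> i *\<^sub>R ((B u - B v) + (C u - C v))) \<le> \<omega> i * (K * norm (u - v))"
        using w by simp
      then show ?thesis by (simp add: algebra_simps)
    qed
    \<comment> \<open>The step \<open>\<mu> / \<omega> i\<close> and the perturbation scaled by
      \<open>\<omega> i\<close> produce the factor \<open>1 / \<omega> i\<close> in front of
      \<open>t\<close>, while the weights cancel in the contraction constant.\<close>
    from perturbed_resolvent_exists[OF A[OF i] lip, of "\<mu> / \<omega> i" "p + \<mu> *\<^sub>R ((1 / \<gamma>) *\<^sub>R (p - \<zeta> i))"]
    obtain s t where "t \<in> A i s" and eq: "s + (\<mu> / \<omega> i) *\<^sub>R (t + \<omega> i *\<^sub>R (B s + C s)) = p + \<mu> *\<^sub>R ((1 / \<gamma>) *\<^sub>R (p - \<zeta> i))"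
      using w K \<mu> by auto
    moreover have "(\<mu> / \<omega> i) *\<^sub>R (t + \<omega> i *\<^sub>R (B s + C s)) = \<mu> *\<^sub>R ((1 / \<omega> i) *\<^sub>R t + B s + C s)"
      using w by (simp add: scaleR_add_right)
    ultimately show ?thesis by auto
  qed
  then obtain s t where t: "\<And>i. i \<in> I \<Longrightarrow> t i \<in> A i (s i)"
    and eq: "\<And>i. i \<in> I \<Longrightarrow> s i + \<mu> *\<^sub>R ((1 / \<omega> i) *\<^sub>R t i + B (s i) + C (s i)) = p + \<mu> *\<^sub>R ((1 / \<gamma>) *\<^sub>R (p - \<zeta> i))"
    by metis
  have diff: "(1 / \<gamma>) *\<^sub>R (p - \<zeta> i) - ((1 / \<omega> i) *\<^sub>R t i + B (s i) + C (s i)) = (- (1 / \<mu>)) *\<^sub>R (p - s i)" (is "?l = _")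
    if i: "i \<in> I" for i
  proof -
    have "\<mu> *\<^sub>R ?l = s i - p" using eq[OF i] by (simp add: algebra_simps)
    then have "(1 / \<mu>) *\<^sub>R (\<mu> *\<^sub>R ?l) = (1 / \<mu>) *\<^sub>R (s i - p)" by simp
    then show ?thesis using \<mu>(1) by (simp add: algebra_simps)
  qed
  have "0 \<le> (\<Sum>i\<in>I. \<omega> i * ((p - s i) \<bullet> ((- (1 / \<mu>)) *\<^sub>R (p - s i))))"
    using test[OF t] by (simp add: diff)
  also have "\<dots> = - (wsq (\<lambda>i. p - s i) / \<mu>)"
    unfolding inner_scaleR_right power2_norm_eq_inner[symmetric] wsq_def sum_divide_distrib sum_negf[symmetric]
    by (intro sum.cong refl) simp
  finally have "wsq (\<lambda>i. p - s i) \<le> 0" using \<mu>(1) by (simp add: divide_le_0_iff)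
  then have "wsq (\<lambda>i. p - s i) = 0" using wsq_nonneg by (rule antisym)
  then have sp: "s i = p" if "i \<in> I" for i
    using wsq_eq_0D that by fastforce
  have "(\<omega> i / \<gamma>) *\<^sub>R (p - \<zeta> i - \<gamma> *\<^sub>R B p - \<gamma> *\<^sub>R C p) \<in> A i p" if i: "i \<in> I" for i
  proof -
    have "(1 / \<gamma>) *\<^sub>R (p - \<zeta> i) - B p - C p = (1 / \<omega> i) *\<^sub>R t i"
      using diff[OF i] unfolding sp[OF i] by (simp add: algebra_simps)
    then have "\<omega> i *\<^sub>R ((1 / \<gamma>) *\<^sub>R (p - \<zeta> i) - B p - C p) = t i" using \<omega>_pos[OF i] by simp
    moreover have "(\<omega> i / \<gamma>) *\<^sub>R (p - \<zeta> i - \<gamma> *\<^sub>R B p - \<gamma> *\<^sub>R C p) = \<omega> i *\<^sub>R ((1 / \<gamma>) *\<^sub>R (p - \<zeta> i) - B p - C p)"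
      using \<gamma>_pos by (simp add: scaleR_diff_right)
    ultimately show ?thesis using t[OF i] sp[OF i] by simp
  qed
  then show ?thesis unfolding fixpoint_def p_def[symmetric] by simp
qed

text \<open>Opial's argument: the difference of the two convergent squared distances is affine in
  \<open>z i n\<close>. Its linear part therefore converges and takes the same value at both
  clusters, which makes their distance zero.\<close>

lemma cluster_unique:
  assumes fp: "fixpoint p \<zeta>" "fixpoint p' \<zeta>'" and cl: "cluster S \<zeta>" "cluster S' \<zeta>'" and i: "i \<in> I"
  shows "\<zeta> i = \<zeta>' i"
proof -
  define g where "g i = \<omega> i *\<^sub>R (\<zeta> i - \<zeta>' i)" for i
  obtain l l' where l: "(\<lambda>n. wsq (\<lambda>i. z i n - \<zeta> i)) \<longlonglongrightarrow> l" and l': "(\<lambda>n. wsq (\<lambda>i. z i n - \<zeta>' i)) \<longlonglongrightarrow> l'"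
    using wsq_z_convergent[OF fp(1)] wsq_z_convergent[OF fp(2)] unfolding convergent_def by blast
  have "(\<Sum>i\<in>I. z i n \<bullet> g i) = (wsq \<zeta> - wsq \<zeta>' - (wsq (\<lambda>i. z i n - \<zeta> i) - wsq (\<lambda>i. z i n - \<zeta>' i))) / 2" for n
    unfolding wsq_def g_def sum_subtractf[symmetric] sum_divide_distrib
    by (intro sum.cong refl) (simp add: power2_norm_eq_inner inner_simps inner_commute algebra_simps)
  then have lim: "(\<lambda>n. \<Sum>i\<in>I. z i n \<bullet> g i) \<longlonglongrightarrow> (wsq \<zeta> - wsq \<zeta>' - (l - l')) / 2"
    by (simp only:) (intro tendsto_intros l l', simp)
  have "(\<Sum>i\<in>I. \<zeta> i \<bullet> g i) - (\<Sum>i\<in>I. \<zeta>' i \<bullet> g i) = 0"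
    using cluster_tendsto[OF cl(1) lim] cluster_tendsto[OF cl(2) lim] by simp
  also have "(\<Sum>i\<in>I. \<zeta> i \<bullet> g i) - (\<Sum>i\<in>I. \<zeta>' i \<bullet> g i) = wsq (\<lambda>i. \<zeta> i - \<zeta>' i)"
    unfolding wsq_def g_def sum_subtractf[symmetric] inner_diff_left[symmetric] power2_norm_eq_inner by simp
  finally show ?thesis using wsq_eq_0D[OF _ i] by fastforce
qed

theorem weak_convergence:
  assumes "fixpoint p0 \<zeta>0"
  shows "\<exists>p \<zeta>. fixpoint p \<zeta> \<and> weakly_converges x p"
proof -
  obtain \<zeta> where cl: "cluster UNIV \<zeta>" using cluster_exists[OF assms] by blast
  define p where "p = (\<Sum>i\<in>I. \<omega> i *\<^sub>R \<zeta> i)"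
  have p: "fixpoint p \<zeta>" unfolding p_def by (rule cluster_fixpoint[OF assms cl])
  have upper: "\<forall>\<^sub>F n in sequentially. x (Suc n) \<bullet> v < c" if c: "p \<bullet> v < c" for v c
  proof (rule ccontr)
    \<comment> \<open>A cluster along the indices that violate the bound must coincide with
      \<open>\<zeta>\<close>, although its mean stays in the wrong half-space.\<close>
    define S where "S = {n. c \<le> x (Suc n) \<bullet> v}"
    assume "\<not> ?thesis"
    then have "infinite S"
      unfolding S_def by (simp add: not_eventually frequently_cofinite cofinite_eq_sequentially[symmetric] not_less)
    then obtain \<zeta>' where cl': "cluster S \<zeta>'" using cluster_exists[OF assms] by blast
    have eq: "(\<Sum>i\<in>I. u i \<bullet> (\<omega> i *\<^sub>R v)) = (\<Sum>i\<in>I. \<omega> i *\<^sub>R u i) \<bullet> v" for u :: "'i \<Rightarrow> 'a"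
      by (simp add: inner_sum_left)
    have "c \<le> (\<Sum>i\<in>I. \<zeta>' i \<bullet> (\<omega> i *\<^sub>R v))"
    proof -
      have "\<forall>\<^sub>F k in sequentially. k \<in> S \<longrightarrow> c \<le> (\<Sum>i\<in>I. z i k \<bullet> (\<omega> i *\<^sub>R v))"
        unfolding eq x_step[symmetric] by (simp add: S_def)
      then show ?thesis
        using cl'[unfolded cluster_def, rule_format, of c "\<lambda>i. \<omega> i *\<^sub>R v"] by simp
    qed
    also have "\<dots> = (\<Sum>i\<in>I. \<zeta> i \<bullet> (\<omega> i *\<^sub>R v))"
      using cluster_unique[OF p cluster_fixpoint[OF assms cl'] cl cl'] by (intro sum.cong) auto
    also have "\<dots> = p \<bullet> v" unfolding eq p_def ..
    finally show False using c by simp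
  qed
  have "(\<lambda>n. x n \<bullet> v) \<longlonglongrightarrow> p \<bullet> v" for v
  proof (rule LIMSEQ_imp_Suc, rule order_tendstoI)
    fix c assume "c < p \<bullet> v"
    then have "\<forall>\<^sub>F n in sequentially. x (Suc n) \<bullet> (- v) < - c" by (intro upper) simp
    then show "\<forall>\<^sub>F n in sequentially. c < x (Suc n) \<bullet> v" by simp
  qed (rule upper)
  with p show ?thesis unfolding weakly_converges_def by blast
qed

end

section \<open>Transfer to the resolvent iteration and its zeros\<close>

theorem theorem4p2:
  fixes A :: "nat \<Rightarrow> 'a::{real_inner, complete_space} \<Rightarrow> 'a set"
    and B C :: "'a \<Rightarrow> 'a"
    and m :: nat and L \<beta> \<gamma> a :: real and \<omega> :: "nat \<Rightarrow> real"
    and x :: "nat \<Rightarrow> 'a" and y :: "nat \<Rightarrow> int \<Rightarrow> 'a" and z :: "nat \<Rightarrow> nat \<Rightarrow> 'a"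
  assumes m: "m \<ge> 1"
    and A: "\<forall>i\<in>{1..m}. maximally_monotone (A i)"
    and Bmono: "monotone_fun B" and L: "L > 0" and Blip: "L-lipschitz_on UNIV B"
    and beta: "\<beta> > 0" and Ccoco: "cocoercive \<beta> C"
    and nonempty: "zer_sum m A B C \<noteq> {}"
    and omega: "\<forall>i\<in>{1..m}. 0 < \<omega> i \<and> \<omega> i \<le> 1" and omega_sum: "(\<Sum>i=1..m. \<omega> i) = 1"
    and a_def: "a = (17 * \<beta> * L + 10 + sqrt ((17 * \<beta> * L + 10)\<^sup>2 + 144 * \<beta>\<^sup>2 * L\<^sup>2)) / (6 * \<beta> * L)"
    and gamma: "0 < \<gamma>" "\<gamma> < \<beta> / (5 + (10 + 6 / a) * \<beta> * L)"
    and x_step: "\<forall>n. x (Suc n) = (\<Sum>j=1..m. \<omega> j *\<^sub>R z j n)"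
    and y_step: "\<forall>n. \<forall>i\<in>{1..m}. y i (int n + 1) =
        resolvent (scale_op (\<gamma> / \<omega> i) (A i))
          (2 *\<^sub>R x (Suc n) - z i n - \<gamma> *\<^sub>R B (2 *\<^sub>R y i (int n) - y i (int n - 1))
             - \<gamma> *\<^sub>R C (y i (int n)))"
    and z_step: "\<forall>n. \<forall>i\<in>{1..m}. z i (Suc n) = z i n + y i (int n + 1) - x (Suc n)"
  shows "\<exists>p. p \<in> zer_sum m A B C \<and> weakly_converges x p"
proof -
  interpret splitting_iteration "{1..m}" A B C \<omega> L \<beta> \<gamma> x "\<lambda>i n. y i (int n - 1)" z
  proof
    show "norm (B u - B v) \<le> L * norm (u - v)" for u v
      using lipschitz_onD[OF Blip, of u v] by (simp add: dist_norm)
    show "2 * (\<gamma> / \<beta>) + 21/2 * (\<gamma> * L) < 1"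
      by (rule step_size_bound[OF L beta a_def gamma])
    show "z i (Suc n) = z i n + y i (int (Suc (Suc n)) - 1) - x (Suc n)" if "i \<in> {1..m}" for i n
      using z_step that by (simp add: add.commute)
    fix i n assume i: "i \<in> {1..m}"
    define w where "w = 2 *\<^sub>R x (Suc n) - z i n - \<gamma> *\<^sub>R B (2 *\<^sub>R y i (int n) - y i (int n - 1)) - \<gamma> *\<^sub>R C (y i (int n))"
    have yw: "y i (int n + 1) = resolvent (scale_op (\<gamma> / \<omega> i) (A i)) w" using y_step i unfolding w_def by blast
    have "0 < \<gamma> / \<omega> i" using omega i gamma by simp
    then have "(1 / (\<gamma> / \<omega> i)) *\<^sub>R (w - y i (int n + 1)) \<in> A i (y i (int n + 1))"
      unfolding yw using A i by (intro resolvent_inclusion) auto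
    moreover have "w - y i (int n + 1) =
        x (Suc n) - z i (Suc n) - \<gamma> *\<^sub>R B (2 *\<^sub>R y i (int n) - y i (int n - 1)) - \<gamma> *\<^sub>R C (y i (int n))"
      unfolding w_def using z_step i by (simp add: scaleR_2 algebra_simps)
    ultimately show "(\<omega> i / \<gamma>) *\<^sub>R (x (Suc n) - z i (Suc n)
        - \<gamma> *\<^sub>R B (2 *\<^sub>R y i (int (Suc n) - 1) - y i (int n - 1)) - \<gamma> *\<^sub>R C (y i (int (Suc n) - 1)))
      \<in> A i (y i (int (Suc (Suc n)) - 1))"
      by (simp add: add.commute)
  qed (use A Bmono L beta Ccoco omega omega_sum gamma x_step in auto)
  obtain p0 u where u: "\<And>i. i \<in> {1..m} \<Longrightarrow> u i \<in> A i p0" and u0: "(\<Sum>i=1..m. u i) + B p0 + C p0 = 0"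
    using nonempty unfolding zer_sum_def by blast
  \<comment> \<open>Chosen so that the element of \<open>A i p0\<close> encoded by the tuple is
    \<open>u i\<close>; the mean is \<open>p0\<close> exactly because the inclusion holds at
    \<open>p0\<close>.\<close>
  have "fixpoint p0 (\<lambda>i. p0 - \<gamma> *\<^sub>R ((1 / \<omega> i) *\<^sub>R u i + B p0 + C p0))"
    unfolding fixpoint_def
  proof (intro conjI ballI)
    have "(\<Sum>i=1..m. \<omega> i *\<^sub>R (p0 - \<gamma> *\<^sub>R ((1 / \<omega> i) *\<^sub>R u i + B p0 + C p0))) =
        (\<Sum>i=1..m. \<omega> i *\<^sub>R (p0 - \<gamma> *\<^sub>R (B p0 + C p0)) - \<gamma> *\<^sub>R u i)"
      using \<omega>_pos by (intro sum.cong refl) (force simp: algebra_simps)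
    also have "\<dots> = p0 - \<gamma> *\<^sub>R ((\<Sum>i=1..m. u i) + B p0 + C p0)"
      unfolding sum_subtractf wsum_const_vec scaleR_sum_right[symmetric] by (simp add: algebra_simps)
    finally show "(\<Sum>i=1..m. \<omega> i *\<^sub>R (p0 - \<gamma> *\<^sub>R ((1 / \<omega> i) *\<^sub>R u i + B p0 + C p0))) = p0"
      using u0 by simp
    fix i assume i: "i \<in> {1..m}"
    have "(\<omega> i / \<gamma>) *\<^sub>R (p0 - (p0 - \<gamma> *\<^sub>R ((1 / \<omega> i) *\<^sub>R u i + B p0 + C p0)) - \<gamma> *\<^sub>R B p0 - \<gamma> *\<^sub>R C p0) = u i"
      using \<omega>_pos[OF i] gamma(1) by (simp add: algebra_simps)
    with u[OF i] show "(\<omega> i / \<gamma>) *\<^sub>R (p0 - (p0 - \<gamma> *\<^sub>R ((1 / \<omega> i) *\<^sub>R u i + B p0 + C p0)) - \<gamma> *\<^sub>R B p0 - \<gamma> *\<^sub>R C p0) \<in> A i p0"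
      by simp
  qed
  from weak_convergence[OF this] obtain p \<zeta> where p: "fixpoint p \<zeta>" and weak: "weakly_converges x p" by blast
  \<comment> \<open>Conversely, since the mean of \<open>\<zeta>\<close> is \<open>p\<close>, these
    elements of \<open>A i p\<close> sum to \<open>- B p - C p\<close>.\<close>
  define v where "v i = (\<omega> i / \<gamma>) *\<^sub>R (p - \<zeta> i - \<gamma> *\<^sub>R B p - \<gamma> *\<^sub>R C p)" for i
  have "(\<Sum>i=1..m. v i) = (1 / \<gamma>) *\<^sub>R (\<Sum>i=1..m. \<omega> i *\<^sub>R (p - \<gamma> *\<^sub>R B p - \<gamma> *\<^sub>R C p) - \<omega> i *\<^sub>R \<zeta> i)"
    unfolding v_def scaleR_sum_right by (intro sum.cong refl) (simp add: algebra_simps)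
  also have "\<dots> = (1 / \<gamma>) *\<^sub>R (p - \<gamma> *\<^sub>R B p - \<gamma> *\<^sub>R C p - p)"
    using p unfolding sum_subtractf wsum_const_vec fixpoint_def by simp
  also have "\<dots> = - B p - C p" using gamma(1) by (simp add: scaleR_diff_right)
  finally have "(\<Sum>i=1..m. v i) + B p + C p = 0" by simp
  moreover have "\<forall>i\<in>{1..m}. v i \<in> A i p" using p unfolding fixpoint_def v_def by blast
  ultimately have "p \<in> zer_sum m A B C" unfolding zer_sum_def by blast
  with weak show ?thesis by blast
qed

end
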